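(* Let $d=1$ and $0<a<1/4$. Then there exists $f\in\mathfrak{L}^2_a(\mathbb{R})$ such that $\lim_{t\to0}|e^{-itH}f(x)|=\infty$ for almost every $x\in\mathbb{R}$.
   Context: $H=-\frac{d^2}{dx^2}+x^2$ on $\mathbb{R}$. Hermite functions $h_k(x)=(-1)^k(2^kk!\pi^{1/2})^{-1/2}H_k(x)e^{-x^2/2}$ form an orthonormal basis of $L^2(\mathbb{R})$ with $Hh_k=(2k+1)h_k$. For $f=\sum_ka_kh_k\in L^2(\mathbb{R})$, $e^{-itH}f=\sum_ka_ke^{-it(2k+1)}h_k$. For $a>0$, $H^{-a/2}f=\sum_k(2k+1)^{-a/2}a_kh_k$, and $\mathfrak{L}^2_a=H^{-a/2}(L^2(\mathbb{R}))$ with norm $\|f\|_{\mathfrak{L}^2_a}=\|g\|_2$ where $H^{-a/2}g=f$.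
   Formalization: The limit as t→0 is replaced by the upper limit: limsup |e^{-itH}f(x)| = ∞ for a.e. x. A true limit is impossible, since e^{-itH}f → f in L² forces a.e. convergence to the finite value f(x) along some sequence t_n→0. *)

theory Defs
  imports "HOL-Analysis.Analysis"
begin

text \<open>
  Elements of \<open>L\<^sup>2(\<real>)\<close> are represented by square-integrable Borel functions, not by
  equivalence classes. Operators on \<open>L\<^sup>2(\<real>)\<close> are therefore relations between
  representatives, closed under almost everywhere equality in both arguments.
\<close>

definition L2 :: "(real \<Rightarrow> complex) set" where
  "L2 = {f \<in> borel_measurable lborel. integrable lborel (\<lambda>x. (cmod (f x))\<^sup>2)}"

definition L2_norm :: "(real \<Rightarrow> complex) \<Rightarrow> real" where
  "L2_norm f = sqrt (LINT x|lborel. (cmod (f x))\<^sup>2)"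

text \<open>
  Convergence of a series in \<open>L\<^sup>2\<close>. Membership of the terms and of the sum is required
  because the Bochner integral of a non-integrable function is \<open>0\<close>.
\<close>

definition L2_sums :: "(nat \<Rightarrow> real \<Rightarrow> complex) \<Rightarrow> (real \<Rightarrow> complex) \<Rightarrow> bool" where
  "L2_sums F f \<longleftrightarrow> (\<forall>k. F k \<in> L2) \<and> f \<in> L2 \<and>
     (\<lambda>n. L2_norm (\<lambda>x. f x - (\<Sum>k<n. F k x))) \<longlonglongrightarrow> 0"

text \<open>
  The physicists' Hermite polynomials by Rodrigues' formula (leading coefficient \<open>2 ^ k\<close>).
\<close>

definition hermite_poly :: "nat \<Rightarrow> real \<Rightarrow> real" where
  "hermite_poly k x = (-1) ^ k * exp (x\<^sup>2) * (deriv ^^ k) (\<lambda>y. exp (- (y\<^sup>2))) x"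

definition hermite_fun :: "nat \<Rightarrow> real \<Rightarrow> real" where
  "hermite_fun k x =
     (-1) ^ k * (2 ^ k * fact k * pi powr (1/2)) powr (-1/2) * hermite_poly k x * exp (- (x\<^sup>2) / 2)"

definition hermite_expansion :: "(nat \<Rightarrow> complex) \<Rightarrow> (real \<Rightarrow> complex) \<Rightarrow> bool" where
  "hermite_expansion c f \<longleftrightarrow> L2_sums (\<lambda>k x. c k * complex_of_real (hermite_fun k x)) f"

text \<open>
  \<open>hermite_calculus \<phi> f g\<close> says \<open>g = \<phi>(H) f\<close> for the Hermite operator \<open>H = - d\<^sup>2/dx\<^sup>2 + x\<^sup>2\<close>,
  whose eigenvalue on \<open>hermite_fun k\<close> is \<open>2 k + 1\<close>.
\<close>

definition hermite_calculus ::
    "(real \<Rightarrow> complex) \<Rightarrow> (real \<Rightarrow> complex) \<Rightarrow> (real \<Rightarrow> complex) \<Rightarrow> bool" where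
  "hermite_calculus \<phi> f g \<longleftrightarrow>
     (\<exists>c. hermite_expansion c f \<and> hermite_expansion (\<lambda>k. \<phi> (2 * real k + 1) * c k) g)"

text \<open>\<open>g = e\<^sup>-\<^sup>i\<^sup>t\<^sup>H f\<close>\<close>

definition hermite_schroedinger :: "real \<Rightarrow> (real \<Rightarrow> complex) \<Rightarrow> (real \<Rightarrow> complex) \<Rightarrow> bool" where
  "hermite_schroedinger t = hermite_calculus (\<lambda>\<mu>. exp (- \<i> * complex_of_real t * complex_of_real \<mu>))"

text \<open>The range of \<open>H\<close> to the power \<open>- a / 2\<close> on \<open>L\<^sup>2(\<real>)\<close>.\<close>

definition hermite_sobolev :: "real \<Rightarrow> (real \<Rightarrow> complex) set" where
  "hermite_sobolev a =
     {f. \<exists>g\<in>L2. hermite_calculus (\<lambda>\<mu>. complex_of_real (\<mu> powr (- a / 2))) g f}"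

end

theory Submission
  imports Defs "HOL-Probability.Probability" "HOL-Complex_Analysis.Complex_Analysis"
begin

text \<open>
  Under \<open>e\<^sup>-\<^sup>i\<^sup>t\<^sup>H\<close> a coherent state of momentum \<open>p\<close> centred at \<open>0\<close> stays a Gaussian of unit width; its
  centre moves to \<open>p sin 2t\<close>. The comb of \<open>N\<close> coherent states with momenta \<open>R, R + 1, \<dots>, R + N - 1\<close> has
  squared norm of order \<open>N\<close>, because distinct terms are almost orthogonal, and squared norm of order
  \<open>N R\<^sup>2\<^sup>a\<close> in the Sobolev space. At the time with \<open>sin 2t = x/R\<close> the terms that are linear in the
  offset \<open>m\<close> cancel from the phases at \<open>x\<close>, and what remains is of size \<open>N\<^sup>2\<bar>x\<bar>/R\<close>; so with \<open>R = (j + 1) N\<^sup>2\<close>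
  the comb has modulus at least \<open>3N/4\<close> there. Combs of amplitude \<open>8\<^sup>j\<close>, that is with weight \<open>8\<^sup>j/N\<close>,
  are summable in the Sobolev space as soon as the \<open>N\<^sub>j\<close> grow fast, since \<open>N\<^sup>4\<^sup>a\<^sup>-\<^sup>1 \<rightarrow> 0\<close>. At the focusing
  time of the \<open>j\<close>-th comb the earlier combs contribute at most \<open>8\<^sup>j/7\<close> and the later ones have
  already moved far away from \<open>x\<close>. All times can be taken rational, so that only countably many
  representatives \<open>u t\<close> are involved.
\<close>

subsection \<open>Hermite functions and their generating function\<close>

text \<open>
  Polymorphic, because the real instance is needed for Rodrigues' formula and the complex one for the
  Taylor series of \<open>exp (- z\<^sup>2)\<close>.
\<close>

primrec gauss_poly :: "nat \<Rightarrow> 'a::real_normed_field poly" where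
  "gauss_poly 0 = 1"
| "gauss_poly (Suc k) = pderiv (gauss_poly k) - [:0, 2:] * gauss_poly k"

lemma deriv_gauss:
  "(deriv ^^ k) (\<lambda>y. exp (- (y\<^sup>2))) = (\<lambda>x::'a::{banach,real_normed_field}. poly (gauss_poly k) x * exp (- (x\<^sup>2)))"
proof (induction k)
  case (Suc k)
  show ?case
  proof
    fix x :: 'a
    have "((\<lambda>x::'a. poly (gauss_poly k) x * exp (- (x\<^sup>2))) has_field_derivative
        poly (gauss_poly (Suc k)) x * exp (- (x\<^sup>2))) (at x)"
      by (auto intro!: derivative_eq_intros poly_DERIV simp: algebra_simps)
    then show "(deriv ^^ Suc k) (\<lambda>y. exp (- (y\<^sup>2))) x = poly (gauss_poly (Suc k)) x * exp (- (x\<^sup>2))"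
      using Suc by (simp add: DERIV_imp_deriv del: gauss_poly.simps)
  qed
qed auto

lemma coeff_gauss_poly_of_real:
  "coeff (gauss_poly k :: 'a::real_normed_field poly) i = of_real (coeff (gauss_poly k) i)"
proof (induction k arbitrary: i)
  case (Suc k)
  then show ?case by (simp add: coeff_pderiv coeff_pCons split: nat.splits)
qed (simp add: coeff_pCons one_pCons split: nat.splits)

text \<open>Lets the Taylor coefficients of the complex function \<open>exp (- z^2)\<close> at a
  real point be read as real Hermite polynomials up to sign.\<close>

lemma poly_gauss_poly_of_real:
  "poly (gauss_poly k) (of_real x :: 'a::real_normed_field) = of_real (poly (gauss_poly k) x)"
proof -
  have "gauss_poly k = map_poly of_real (gauss_poly k) "
    by (intro poly_eqI, subst coeff_map_poly, simp, rule coeff_gauss_poly_of_real)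
  moreover have "poly (map_poly of_real p) (of_real x :: 'a) = of_real (poly p x)" for p
    by (induction p) (auto simp: map_poly_pCons)
  ultimately show ?thesis by metis
qed

lemma degree_gauss_poly:
  "degree (gauss_poly k :: real poly) = k \<and> lead_coeff (gauss_poly k :: real poly) = (-2) ^ k"
proof (induction k)
  case (Suc k)
  have 1: "coeff (gauss_poly (Suc k) :: real poly) (Suc k) = (-2) ^ Suc k"
    using Suc by (auto simp: coeff_pderiv coeff_eq_0)
  have "degree (gauss_poly (Suc k) :: real poly) \<le> Suc k"
    using Suc by (intro degree_le) (auto simp: coeff_pderiv coeff_pCons coeff_eq_0 split: nat.splits)
  moreover have "degree (gauss_poly (Suc k) :: real poly) \<ge> Suc k"
    by (intro le_degree) (simp add: 1 del: gauss_poly.simps)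
  ultimately have "degree (gauss_poly (Suc k) :: real poly) = Suc k"
    by (rule antisym)
  with 1 show ?case by (simp del: gauss_poly.simps)
qed auto

section \<open>Gaussian integrals and orthonormality of the Hermite functions\<close>

lemma integrable_poly_gauss:
  "integrable lborel (\<lambda>x. poly Q x * exp (- (x\<^sup>2)) :: real)"
proof -
  have "integrable lborel (\<lambda>x::real. x ^ k * exp (- (x\<^sup>2)))" for k
  proof -
    \<comment> \<open>With standard deviation \<open>1 / sqrt 2\<close> the normal density is
      \<open>exp (- (x^2)) / sqrt pi\<close>, so the monomials are covered by its moments.\<close>
    have "integrable lborel (\<lambda>x. sqrt pi * (normal_density 0 (1 / sqrt 2) x * (x - 0) ^ k))"
      by (intro integrable_mult_right integrable_normal_moment) auto
    moreover have "(\<lambda>x. sqrt pi * (normal_density 0 (1 / sqrt 2) x * (x - 0) ^ k)) = (\<lambda>x. x ^ k * exp (- (x\<^sup>2)))"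
      by (auto simp: normal_density_def power2_eq_square)
    ultimately show ?thesis by (simp only:)
  qed
  then have "integrable lborel (\<lambda>x::real. \<Sum>k\<le>degree Q. coeff Q k * (x ^ k * exp (- (x\<^sup>2))))"
    by (intro Bochner_Integration.integrable_sum integrable_mult_right)
  then show ?thesis by (simp add: poly_altdef sum_distrib_right mult.assoc)
qed

lemma integral_gauss: "(LINT x|lborel. exp (- (x\<^sup>2))) = sqrt (pi :: real)"
proof -
  have "(LINT x|lborel. sqrt pi * normal_density 0 (1 / sqrt 2) x) = sqrt pi"
    by simp
  moreover have "sqrt pi * normal_density 0 (1 / sqrt 2) x = exp (- (x\<^sup>2))" for x
    by (simp add: normal_density_def power2_eq_square)
  ultimately show ?thesis by simp
qed

lemma poly_gauss_tendsto:
  "((\<lambda>x::real. poly Q x * exp (- (x\<^sup>2))) \<longlongrightarrow> 0) at_top"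
proof -
  have "((\<lambda>x::real. \<Sum>k\<le>degree Q. coeff Q k * (x ^ k * exp (- (x\<^sup>2)))) \<longlongrightarrow> (\<Sum>k\<le>degree Q. coeff Q k * 0)) at_top"
  proof (intro tendsto_sum tendsto_mult tendsto_const)
    fix k
    show "((\<lambda>x::real. x ^ k * exp (- (x\<^sup>2))) \<longlongrightarrow> 0) at_top"
    proof (rule tendsto_sandwich[OF _ _ tendsto_const tendsto_power_div_exp_0])
      show "\<forall>\<^sub>F x::real in at_top. 0 \<le> x ^ k * exp (- (x\<^sup>2))"
        using eventually_ge_at_top[of 0] by eventually_elim auto
      show "\<forall>\<^sub>F x::real in at_top. x ^ k * exp (- (x\<^sup>2)) \<le> x ^ k / exp x"
        using eventually_ge_at_top[of 1]
      proof eventually_elim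
        case (elim x)
        then have "exp (- (x\<^sup>2)) \<le> exp (- x)" by (simp add: power2_eq_square)
        with elim show ?case by (auto simp: exp_minus divide_inverse intro!: mult_left_mono)
      qed
    qed
  qed
  then show ?thesis by (simp add: poly_altdef sum_distrib_right mult.assoc)
qed

text \<open>The integrand is the derivative of \<open>Q\<close> times the Gaussian, which vanishes
  at both infinities.\<close>

lemma integral_poly_gauss_deriv:
  fixes Q :: "real poly"
  shows "(LINT x|lborel. poly (pderiv Q - [:0, 2:] * Q) x * exp (- (x\<^sup>2))) = 0"
proof -
  let ?F = "\<lambda>x::real. poly Q x * exp (- (x\<^sup>2))"
  let ?f = "\<lambda>x::real. poly (pderiv Q - [:0, 2:] * Q) x * exp (- (x\<^sup>2))"
  have bot: "(?F \<longlongrightarrow> 0) at_bot"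
  proof -
    have "((\<lambda>x. poly (Q \<circ>\<^sub>p [:0, -1:]) x * exp (- (x\<^sup>2))) \<longlongrightarrow> 0) at_top"
      by (rule poly_gauss_tendsto)
    then have "((\<lambda>x. ?F (- x)) \<longlongrightarrow> 0) at_top" by (simp add: poly_pcompose)
    then show ?thesis by (subst filterlim_at_bot_mirror)
  qed
  have "(LBINT x=-\<infinity>..\<infinity>. ?f x) = 0 - 0"
  proof (rule interval_integral_FTC_integrable)
    show "(?F has_vector_derivative ?f x) (at x)" for x
      unfolding has_real_derivative_iff_has_vector_derivative[symmetric]
      by (auto intro!: derivative_eq_intros poly_DERIV simp: algebra_simps)
    show "isCont ?f x" for x by (intro continuous_intros) 
    show "set_integrable lborel (einterval (-\<infinity>) \<infinity>) ?f"
      by (simp add: set_integrable_def integrable_poly_gauss del: poly_diff poly_mult)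
    show "((?F \<circ> real_of_ereal) \<longlongrightarrow> 0) (at_right (-\<infinity>))"
      using bot by (simp only: ereal_tendsto_simps)
    show "((?F \<circ> real_of_ereal) \<longlongrightarrow> 0) (at_left \<infinity>)"
      using poly_gauss_tendsto by (simp only: ereal_tendsto_simps)
  qed auto
  then show ?thesis by (simp add: interval_lebesgue_integral_def set_lebesgue_integral_def)
qed

text \<open>Integration by parts \<open>k\<close> times: each derivative leaves the Gaussian and
  falls on \<open>Q\<close>, with a change of sign.\<close>

lemma integral_gauss_poly_mult:
  fixes Q :: "real poly"
  shows "(LINT x|lborel. poly (gauss_poly k * Q) x * exp (- (x\<^sup>2))) =
    (-1) ^ k * (LINT x|lborel. poly ((pderiv ^^ k) Q) x * exp (- (x\<^sup>2)))"
proof (induction k arbitrary: Q)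
  case (Suc k)
  let ?P = "gauss_poly k :: real poly"
  have eq: "gauss_poly (Suc k) * Q = (pderiv (?P * Q) - [:0, 2:] * (?P * Q)) - ?P * pderiv Q"
    by (simp add: pderiv_mult algebra_simps)
  have "(LINT x|lborel. poly (gauss_poly (Suc k) * Q) x * exp (- (x\<^sup>2))) =
    (LINT x|lborel. poly (pderiv (?P * Q) - [:0, 2:] * (?P * Q)) x * exp (- (x\<^sup>2)) - poly (?P * pderiv Q) x * exp (- (x\<^sup>2)))"
    unfolding eq by (simp only: poly_diff left_diff_distrib)
  also have "\<dots> = - (LINT x|lborel. poly (?P * pderiv Q) x * exp (- (x\<^sup>2)))"
    unfolding Bochner_Integration.integral_diff[OF integrable_poly_gauss integrable_poly_gauss]
      integral_poly_gauss_deriv by simp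
  also have "\<dots> = (-1) ^ Suc k * (LINT x|lborel. poly ((pderiv ^^ Suc k) Q) x * exp (- (x\<^sup>2)))"
    by (simp add: Suc funpow_Suc_right del: funpow.simps poly_mult)
  finally show ?case .
qed auto

lemma pderiv_funpow_degree:
  fixes Q :: "real poly"
  assumes "degree Q \<le> k"
  shows "(pderiv ^^ k) Q = [:fact k * coeff Q k:]"
  using assms
proof (induction k arbitrary: Q)
  case 0
  then obtain c where "Q = [:c:]" using degree_eq_zeroE by auto
  then show ?case by simp
next
  case (Suc k)
  have "(pderiv ^^ Suc k) Q = (pderiv ^^ k) (pderiv Q)" by (simp add: funpow_Suc_right del: funpow.simps)
  also have "\<dots> = [:fact k * coeff (pderiv Q) k:]"
    using Suc.prems by (intro Suc.IH) (simp add: degree_pderiv)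
  finally show ?case by (simp add: coeff_pderiv algebra_simps)
qed

text \<open>For \<open>j \<le> k\<close> the \<open>k\<close> derivatives that fall on
  \<open>gauss_poly j\<close> leave a constant: zero if \<open>j < k\<close>, and
  \<open>fact k * (-2) ^ k\<close> if \<open>j = k\<close>. The sign \<open>(-1) ^ k\<close> from
  the integrations by parts makes the latter positive. The other case follows by symmetry.\<close>

lemma integral_gauss_poly_gauss_poly:
  "(LINT x|lborel. poly (gauss_poly j) x * poly (gauss_poly k) x * exp (- (x\<^sup>2))) =
    (if j = k then 2 ^ k * fact k * sqrt (pi :: real) else 0)"
proof -
  have main: "(LINT x|lborel. poly (gauss_poly k) x * poly (gauss_poly j) x * exp (- (x\<^sup>2))) =
    (if j = k then 2 ^ k * fact k * sqrt (pi :: real) else 0)" if "j \<le> k" for j k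
  proof -
    have "(pderiv ^^ k) (gauss_poly j :: real poly) = [:fact k * coeff (gauss_poly j) k:]"
      using that degree_gauss_poly[of j] by (intro pderiv_funpow_degree) auto
    moreover have "coeff (gauss_poly j :: real poly) k = (if j = k then (-2) ^ k else 0)"
      using that degree_gauss_poly[of j] by (auto simp: coeff_eq_0)
    ultimately show ?thesis
      using integral_gauss_poly_mult[of k "gauss_poly j"]
      by (auto simp: integral_gauss power_mult_distrib[symmetric])
  qed
  show ?thesis
  proof (cases "j \<le> k")
    case True
    then show ?thesis using main[of j k] by (simp add: mult.commute[of "poly (gauss_poly j) _"])
  next
    case False
    then show ?thesis using main[of k j] by auto
  qed
qed

definition hermite_const :: "nat \<Rightarrow> real" where
  "hermite_const k = (2 ^ k * fact k * sqrt pi) powr (-1/2)"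

lemma hermite_const_square: "(hermite_const k)\<^sup>2 = 1 / (2 ^ k * fact k * sqrt pi)"
proof -
  define c where "c = (2 ^ k * fact k * sqrt pi :: real)"
  have "c > 0" by (simp add: c_def)
  then have "(c powr (-1/2))\<^sup>2 = c powr (- 1)"
    by (simp add: power2_eq_square flip: powr_add)
  also have "\<dots> = 1 / c"
    using \<open>c > 0\<close> by (simp add: powr_minus_divide)
  finally show ?thesis by (simp add: hermite_const_def c_def)
qed

text \<open>The factor \<open>(-1) ^ k\<close> of \<open>hermite_fun\<close> cancels the one in
  Rodrigues' formula, so the derivatives of the Gaussian appear without a sign.\<close>

lemma hermite_fun_eq:
  "hermite_fun k x = hermite_const k * poly (gauss_poly k) x * exp (- (x\<^sup>2) / 2)"
proof -
  have "exp (x\<^sup>2) * exp (- (x\<^sup>2)) = 1"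
    by (simp add: exp_minus)
  moreover have "(-1 :: real) ^ k * (-1) ^ k = 1"
    by (simp flip: power_mult_distrib)
  moreover have "hermite_fun k x = ((-1) ^ k * (-1) ^ k) * (exp (x\<^sup>2) * exp (- (x\<^sup>2))) *
      (hermite_const k * poly (gauss_poly k) x * exp (- (x\<^sup>2) / 2))"
    unfolding hermite_fun_def hermite_poly_def deriv_gauss hermite_const_def
      powr_half_sqrt[OF less_imp_le[OF pi_gt_zero]]
    by (simp only: mult_ac)
  ultimately show ?thesis by (simp only: mult_1_left)
qed

lemma hermite_fun_mult:
  "hermite_fun j x * hermite_fun k x =
    hermite_const j * hermite_const k * (poly (gauss_poly j * gauss_poly k) x * exp (- (x\<^sup>2)))"
proof -
  have "exp (- (x\<^sup>2)) = exp (- (x\<^sup>2) / 2) * exp (- (x\<^sup>2) / 2)" by (simp flip: exp_add)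
  then show ?thesis by (simp add: hermite_fun_eq)
qed

lemma integrable_hermite_fun_mult:
  "integrable lborel (\<lambda>x. hermite_fun j x * hermite_fun k x)"
  unfolding hermite_fun_mult by (intro integrable_mult_right integrable_poly_gauss)

lemma integral_hermite_fun_mult:
  "(LINT x|lborel. hermite_fun j x * hermite_fun k x) = (if j = k then 1 else 0)"
proof -
  have "(LINT x|lborel. hermite_fun j x * hermite_fun k x) =
    hermite_const j * hermite_const k * (if j = k then 2 ^ k * fact k * sqrt pi else 0)"
    unfolding hermite_fun_mult using integral_gauss_poly_gauss_poly[of j k] by simp
  also have "\<dots> = (if j = k then (hermite_const k)\<^sup>2 * (2 ^ k * fact k * sqrt pi) else 0)"
    by (auto simp: power2_eq_square)
  also have "\<dots> = (if j = k then 1 else 0)" by (auto simp: hermite_const_square)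
  finally show ?thesis .
qed

lemma continuous_on_hermite_fun: "continuous_on A (hermite_fun k)"
proof -
  have "continuous_on A (\<lambda>x. hermite_const k * poly (gauss_poly k) x * exp (- (x\<^sup>2) / 2))"
    by (intro continuous_intros) auto
  then show ?thesis by (simp add: hermite_fun_eq)
qed

lemma borel_measurable_hermite_fun [measurable]: "hermite_fun k \<in> borel_measurable borel"
  by (intro borel_measurable_continuous_onI continuous_on_hermite_fun)

text \<open>
  Since \<open>hermite_fun k\<close> is \<open>(- 1) ^ k\<close> times the usual Hermite function, \<open>z\<close> is replaced
  by \<open>- z\<close> in the usual generating function.
\<close>

lemma hermite_generating:
  fixes z :: complex
  shows "(\<lambda>k. z ^ k / of_real (sqrt (fact k)) * of_real (hermite_fun k x)) sums
    (of_real (pi powr (-1/4)) * exp (- (of_real x)\<^sup>2 / 2 - of_real (sqrt 2) * of_real x * z - z\<^sup>2 / 2))"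
proof -
  define w where "w = z / of_real (sqrt 2)"
  define c where "c = pi powr (-1/4)"
  have c: "hermite_const k = c / sqrt 2 ^ k / sqrt (fact k)" for k
  proof -
    have "hermite_const k = (2 ^ k) powr (-1/2) * (fact k) powr (-1/2) * (sqrt pi) powr (-1/2)"
      by (simp add: hermite_const_def powr_mult)
    also have "(2 ^ k :: real) powr (-1/2) = 1 / sqrt 2 ^ k"
      by (simp add: powr_minus_divide powr_half_sqrt real_sqrt_power)
    also have "(fact k :: real) powr (-1/2) = 1 / sqrt (fact k)"
      by (simp add: powr_minus_divide powr_half_sqrt)
    also have "(sqrt pi) powr (-1/2) = c"
      unfolding c_def by (simp add: powr_half_sqrt[symmetric] powr_powr)
    finally show ?thesis by simp
  qed
  \<comment> \<open>Taylor series of an entire function about the real point \<open>x\<close>; the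
    disc of radius \<open>norm w + 1\<close> contains \<open>x + w\<close>.\<close>
  have "(\<lambda>k. (deriv ^^ k) (\<lambda>z. exp (- (z\<^sup>2))) (of_real x) / fact k * (of_real x + w - of_real x) ^ k)
     sums exp (- ((of_real x + w)\<^sup>2))"
    by (rule holomorphic_power_series[where r = "norm w + 1"])
       (auto intro!: holomorphic_intros simp: dist_norm)
  then have "(\<lambda>k. of_real (poly (gauss_poly k) x * exp (- (x\<^sup>2))) / fact k * w ^ k)
     sums exp (- ((of_real x + w)\<^sup>2))"
    by (simp add: deriv_gauss poly_gauss_poly_of_real flip: exp_of_real)
  \<comment> \<open>The factor \<open>exp (x^2 / 2)\<close> turns the weight
    \<open>exp (- (x^2))\<close> into the weight \<open>exp (- (x^2) / 2)\<close> of the Hermite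
    functions.\<close>
  from sums_mult[OF this, of "of_real (c * exp (x\<^sup>2 / 2))"]
  have "(\<lambda>k. of_real (c * exp (x\<^sup>2 / 2)) * (of_real (poly (gauss_poly k) x * exp (- (x\<^sup>2))) / fact k * w ^ k))
     sums (of_real c * exp (of_real x ^ 2 / 2 - ((of_real x + w)\<^sup>2)))"
    by (simp add: exp_of_real[symmetric] mult.assoc flip: exp_add)
  moreover have "of_real (c * exp (x\<^sup>2 / 2)) * (of_real (poly (gauss_poly k) x * exp (- (x\<^sup>2))) / fact k * w ^ k)
     = z ^ k / of_real (sqrt (fact k)) * of_real (hermite_fun k x)" for k
  proof -
    define q where "q = complex_of_real (sqrt (fact k))"
    have q: "fact k = q * q" "q \<noteq> 0" by (simp_all add: q_def flip: of_real_mult)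
    have e: "exp (- (x\<^sup>2) / 2) = exp (x\<^sup>2 / 2) * exp (- (x\<^sup>2))"
      by (simp flip: exp_add)
    show ?thesis
      unfolding hermite_fun_eq c e w_def q(1) power_divide of_real_mult of_real_divide of_real_power q_def[symmetric]
      using q(2) by (simp only: times_divide_eq_right times_divide_eq_left divide_divide_eq_left mult_ac)
  qed
  moreover have "of_real x ^ 2 / 2 - ((of_real x + w)\<^sup>2) = - (of_real x)\<^sup>2 / 2 - of_real (sqrt 2) * of_real x * z - z\<^sup>2 / 2"
  proof -
    have s: "complex_of_real (sqrt 2) * complex_of_real (sqrt 2) = 2" by (simp flip: of_real_mult)
    have "of_real (sqrt 2) * w = z" by (simp add: w_def)
    moreover have "2 * w = of_real (sqrt 2) * z"
      by (simp add: w_def divide_simps) (metis s mult.assoc mult.commute)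
    moreover have "w\<^sup>2 = z\<^sup>2 / 2" by (simp add: w_def power_divide power2_eq_square s)
    ultimately show ?thesis by (simp add: power2_sum algebra_simps)
  qed
  ultimately show ?thesis by (simp add: c_def)
qed

subsection \<open>Hermite expansions\<close>

definition L2_energy :: "(real \<Rightarrow> complex) \<Rightarrow> real" where
  "L2_energy f = (LINT x|lborel. (cmod (f x))\<^sup>2)"

definition hermite_partial :: "(nat \<Rightarrow> complex) \<Rightarrow> nat \<Rightarrow> real \<Rightarrow> complex" where
  "hermite_partial c n x = (\<Sum>k<n. c k * of_real (hermite_fun k x))"

lemma L2_norm_eq: "L2_norm f = sqrt (L2_energy f)"
  by (simp add: L2_norm_def L2_energy_def)

lemma L2_energy_nonneg: "0 \<le> L2_energy f"
  by (simp add: L2_energy_def)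

lemma L2_measurable: "f \<in> L2 \<Longrightarrow> f \<in> borel_measurable borel"
  by (simp add: L2_def)

lemma L2_integrable: "f \<in> L2 \<Longrightarrow> integrable lborel (\<lambda>x. (cmod (f x))\<^sup>2)"
  by (simp add: L2_def)

lemma cmod_add_square_le: "(cmod (x + y))\<^sup>2 \<le> 2 * (cmod x)\<^sup>2 + 2 * (cmod y)\<^sup>2"
proof -
  have "(cmod (x + y))\<^sup>2 \<le> (cmod x + cmod y)\<^sup>2"
    by (intro power_mono norm_triangle_ineq) auto
  also have "\<dots> \<le> 2 * (cmod x)\<^sup>2 + 2 * (cmod y)\<^sup>2"
    using sum_squares_bound[of "cmod x" "cmod y"] by (simp add: power2_sum)
  finally show ?thesis .
qed

lemma L2_add:
  assumes "f \<in> L2" "g \<in> L2"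
  shows "(\<lambda>x. f x + g x) \<in> L2"
proof -
  have [measurable]: "f \<in> borel_measurable borel" "g \<in> borel_measurable borel"
    using assms by (auto intro: L2_measurable)
  have "integrable lborel (\<lambda>x. 2 * (cmod (f x))\<^sup>2 + 2 * (cmod (g x))\<^sup>2)"
    using assms by (auto simp: L2_def)
  then have "integrable lborel (\<lambda>x. (cmod (f x + g x))\<^sup>2)"
    by (rule Bochner_Integration.integrable_bound) (auto simp: cmod_add_square_le)
  then show ?thesis by (simp add: L2_def)
qed

lemma L2_energy_add_le:
  assumes "f \<in> L2" "g \<in> L2"
  shows "L2_energy (\<lambda>x. f x + g x) \<le> 2 * L2_energy f + 2 * L2_energy g"
proof -
  have "L2_energy (\<lambda>x. f x + g x) \<le> (LINT x|lborel. 2 * (cmod (f x))\<^sup>2 + 2 * (cmod (g x))\<^sup>2)"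
    unfolding L2_energy_def using L2_integrable[OF assms(1)] L2_integrable[OF assms(2)] L2_integrable[OF L2_add[OF assms]]
    by (intro integral_mono) (auto simp: cmod_add_square_le)
  then show ?thesis
    using L2_integrable[OF assms(1)] L2_integrable[OF assms(2)] by (simp add: L2_energy_def)
qed

lemma L2_cmult:
  assumes "f \<in> L2"
  shows "(\<lambda>x. c * f x) \<in> L2"
  using assms by (auto simp: L2_def norm_mult power_mult_distrib)

lemma L2_energy_cmult: "L2_energy (\<lambda>x. c * f x) = (cmod c)\<^sup>2 * L2_energy f"
  by (simp add: L2_energy_def norm_mult power_mult_distrib)

lemma L2_diff: "f \<in> L2 \<Longrightarrow> g \<in> L2 \<Longrightarrow> (\<lambda>x. f x - g x) \<in> L2"
  using L2_add[of f "\<lambda>x. (-1) * g x"] L2_cmult[of g "-1"] by simp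

lemma L2_energy_diff_le:
  assumes "f \<in> L2" "g \<in> L2"
  shows "L2_energy (\<lambda>x. f x - g x) \<le> 2 * L2_energy f + 2 * L2_energy g"
  using L2_energy_add_le[OF assms(1) L2_cmult[OF assms(2), of "-1"]]
    L2_energy_cmult[of "-1" g] by simp

lemma L2_hermite_fun: "(\<lambda>x. c * of_real (hermite_fun k x)) \<in> L2"
  using integrable_mult_right[OF integrable_hermite_fun_mult[of k k], of "(cmod c)\<^sup>2"]
  by (simp add: L2_def norm_mult power_mult_distrib flip: power2_eq_square)

lemma L2_sum_hermite:
  assumes "finite A"
  shows "(\<lambda>x. \<Sum>k\<in>A. c k * of_real (hermite_fun k x)) \<in> L2"
  using assms
proof induction
  case empty
  then show ?case by (simp add: L2_def)
next
  case (insert k A)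
  then show ?case using L2_add[OF L2_hermite_fun[of "c k" k] insert.IH] by simp
qed

lemma L2_hermite_partial: "hermite_partial c n \<in> L2"
  unfolding hermite_partial_def[abs_def] by (rule L2_sum_hermite) auto

lemma has_bochner_integral_hermite_fun_mult:
  "has_bochner_integral lborel (\<lambda>x. hermite_fun j x * hermite_fun k x) (if j = k then 1 else 0)"
  using integrable_hermite_fun_mult integral_hermite_fun_mult by (simp add: has_bochner_integral_iff)

lemma has_bochner_integral_real_hermite_sum:
  assumes "finite A"
  shows "has_bochner_integral lborel (\<lambda>x. (\<Sum>k\<in>A. r k * hermite_fun k x)\<^sup>2) (\<Sum>k\<in>A. (r k)\<^sup>2)"
proof -
  have "has_bochner_integral lborel (\<lambda>x. \<Sum>j\<in>A. \<Sum>k\<in>A. (r j * r k) * (hermite_fun j x * hermite_fun k x))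
    (\<Sum>j\<in>A. \<Sum>k\<in>A. (r j * r k) * (if j = k then 1 else 0))"
    by (intro has_bochner_integral_sum has_bochner_integral_mult_right has_bochner_integral_hermite_fun_mult)
  moreover have "(\<Sum>j\<in>A. \<Sum>k\<in>A. (r j * r k) * (if j = k then 1 else 0)) = (\<Sum>k\<in>A. (r k)\<^sup>2)"
    using assms by (simp add: power2_eq_square if_distrib sum.delta cong: if_cong)
  moreover have "(\<Sum>j\<in>A. \<Sum>k\<in>A. (r j * r k) * (hermite_fun j x * hermite_fun k x)) = (\<Sum>k\<in>A. r k * hermite_fun k x)\<^sup>2" for x
    unfolding power2_eq_square sum_product by (simp add: mult_ac)
  ultimately show ?thesis by simp
qed

text \<open>Since the Hermite functions are real, Parseval's identity splits into two real ones, for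
  \<open>Re (c k)\<close> and for \<open>Im (c k)\<close>.\<close>

lemma L2_energy_sum_hermite:
  assumes "finite A"
  shows "L2_energy (\<lambda>x. \<Sum>k\<in>A. c k * of_real (hermite_fun k x)) = (\<Sum>k\<in>A. (cmod (c k))\<^sup>2)"
proof -
  have "has_bochner_integral lborel
      (\<lambda>x. (\<Sum>k\<in>A. Re (c k) * hermite_fun k x)\<^sup>2 + (\<Sum>k\<in>A. Im (c k) * hermite_fun k x)\<^sup>2)
      ((\<Sum>k\<in>A. (Re (c k))\<^sup>2) + (\<Sum>k\<in>A. (Im (c k))\<^sup>2))"
    by (intro has_bochner_integral_add has_bochner_integral_real_hermite_sum assms)
  then show ?thesis
    unfolding L2_energy_def cmod_power2 by (simp add: has_bochner_integral_iff sum.distrib)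
qed

lemma L2_energy_hermite_partial_diff:
  "L2_energy (\<lambda>x. hermite_partial a n x - hermite_partial b n x) = (\<Sum>k<n. (cmod (a k - b k))\<^sup>2)"
  using L2_energy_sum_hermite[of "{..<n}" "\<lambda>k. a k - b k"]
  by (simp add: hermite_partial_def left_diff_distrib sum_subtractf)

lemma hermite_partial_diff:
  assumes "m \<le> n"
  shows "hermite_partial a n x - hermite_partial a m x = (\<Sum>k\<in>{m..<n}. a k * of_real (hermite_fun k x))"
  using assms unfolding hermite_partial_def
  by (metis sum_diff_nat_ivl atLeast0LessThan zero_le)

section \<open>Uniqueness and stability of Hermite coefficients\<close>

lemma hermite_expansion_iff:
  "hermite_expansion c f \<longleftrightarrow>
    f \<in> L2 \<and> (\<lambda>n. L2_energy (\<lambda>x. f x - hermite_partial c n x)) \<longlonglongrightarrow> 0"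
proof -
  have "(\<lambda>n. sqrt (L2_energy (\<lambda>x. f x - hermite_partial c n x))) \<longlonglongrightarrow> 0 \<longleftrightarrow>
    (\<lambda>n. L2_energy (\<lambda>x. f x - hermite_partial c n x)) \<longlonglongrightarrow> 0" (is "?l \<longleftrightarrow> ?r")
  proof
    assume ?l
    from tendsto_power[OF this, of 2] show ?r by (simp add: L2_energy_nonneg)
  next
    assume ?r
    from tendsto_real_sqrt[OF this] show ?l by simp
  qed
  then show ?thesis
    by (auto simp: hermite_expansion_def L2_sums_def L2_hermite_fun L2_norm_eq hermite_partial_def)
qed

lemma hermite_expansion_L2: "hermite_expansion c f \<Longrightarrow> f \<in> L2"
  by (simp add: hermite_expansion_iff)

text \<open>Orthonormality bounds each coefficient of the difference by the distance of the two
  partial sums, and both partial sums tend to \<open>f\<close>. Thus the existential quantifier in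
  \<open>hermite_calculus\<close> leaves no freedom in the coefficients.\<close>

lemma hermite_expansion_unique:
  assumes "hermite_expansion a f" "hermite_expansion b f"
  shows "a = b"
proof
  fix k
  have f: "f \<in> L2" using assms(1) by (rule hermite_expansion_L2)
  have "(cmod (a k - b k))\<^sup>2 \<le> 0"
  proof (rule tendsto_lowerbound)
    show "(\<lambda>n. 2 * L2_energy (\<lambda>x. f x - hermite_partial b n x) + 2 * L2_energy (\<lambda>x. f x - hermite_partial a n x))
      \<longlonglongrightarrow> 0"
      using assms by (auto simp: hermite_expansion_iff intro!: tendsto_eq_intros)
    show "\<forall>\<^sub>F n in sequentially. (cmod (a k - b k))\<^sup>2 \<le> 2 * L2_energy (\<lambda>x. f x - hermite_partial b n x) + 2 * L2_energy (\<lambda>x. f x - hermite_partial a n x)"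
      using eventually_gt_at_top[of k]
    proof eventually_elim
      case (elim n)
      have "(cmod (a k - b k))\<^sup>2 \<le> (\<Sum>k<n. (cmod (a k - b k))\<^sup>2)"
        using elim by (intro member_le_sum) auto
      also have "\<dots> = L2_energy (\<lambda>x. (f x - hermite_partial b n x) - (f x - hermite_partial a n x))"
        by (simp flip: L2_energy_hermite_partial_diff)
      also have "\<dots> \<le> 2 * L2_energy (\<lambda>x. f x - hermite_partial b n x) + 2 * L2_energy (\<lambda>x. f x - hermite_partial a n x)"
        by (intro L2_energy_diff_le L2_diff f L2_hermite_partial)
      finally show ?case .
    qed
  qed auto
  then show "a k = b k" by simp
qed

text \<open>The partial sums differ by energy at most \<open>B\<close> by Parseval, and the two
  remainders vanish in the limit. The factor 2 is the one in
  \<open>L2_energy_add_le\<close>.\<close>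

lemma hermite_expansion_energy_diff_le:
  assumes "hermite_expansion a f" "hermite_expansion b g"
    and "\<And>n. (\<Sum>k<n. (cmod (a k - b k))\<^sup>2) \<le> B"
  shows "L2_energy (\<lambda>x. f x - g x) \<le> 2 * B"
proof (rule tendsto_lowerbound)
  have f: "f \<in> L2" "g \<in> L2" using assms by (auto intro: hermite_expansion_L2)
  let ?e = "\<lambda>n. 2 * (2 * L2_energy (\<lambda>x. f x - hermite_partial a n x) + 2 * L2_energy (\<lambda>x. g x - hermite_partial b n x)) + 2 * B"
  have "?e \<longlonglongrightarrow> 2 * (2 * 0 + 2 * 0) + 2 * B"
    using assms unfolding hermite_expansion_iff by (intro tendsto_intros) auto
  then show "?e \<longlonglongrightarrow> 2 * B" by simp
  have "L2_energy (\<lambda>x. f x - g x) \<le> ?e n" for n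
  proof -
    have "L2_energy (\<lambda>x. f x - g x) = L2_energy (\<lambda>x. ((f x - hermite_partial a n x) - (g x - hermite_partial b n x))
        + (hermite_partial a n x - hermite_partial b n x))"
      by simp
    also have "\<dots> \<le> 2 * L2_energy (\<lambda>x. (f x - hermite_partial a n x) - (g x - hermite_partial b n x))
        + 2 * L2_energy (\<lambda>x. hermite_partial a n x - hermite_partial b n x)"
      by (intro L2_energy_add_le L2_diff L2_hermite_partial f)
    also have "\<dots> \<le> ?e n"
      using assms(3)[of n] unfolding L2_energy_hermite_partial_diff
      by (intro add_mono mult_left_mono L2_energy_diff_le L2_diff L2_hermite_partial f) auto
    finally show ?thesis .
  qed
  then show "\<forall>\<^sub>F n in sequentially. L2_energy (\<lambda>x. f x - g x) \<le> ?e n" by simp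
qed auto

section \<open>Functions with prescribed Hermite coefficients\<close>

lemma nn_integral_L2:
  assumes "f \<in> L2"
  shows "(\<integral>\<^sup>+x. ennreal ((cmod (f x))\<^sup>2) \<partial>lborel) = ennreal (L2_energy f)"
  unfolding L2_energy_def by (intro nn_integral_eq_integral L2_integrable assms) auto

lemma L2_I:
  assumes [measurable]: "f \<in> borel_measurable borel"
    and "(\<integral>\<^sup>+x. ennreal ((cmod (f x))\<^sup>2) \<partial>lborel) \<le> ennreal B" and "0 \<le> B"
  shows "f \<in> L2" "L2_energy f \<le> B"
proof -
  have "integrable lborel (\<lambda>x. (cmod (f x))\<^sup>2)"
    using assms(2) by (intro integrableI_bounded) (auto simp: le_less_trans)
  then show f: "f \<in> L2" by (simp add: L2_def)
  from nn_integral_L2[OF f] assms(2,3) show "L2_energy f \<le> B"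
    by simp
qed

text \<open>Fatou's lemma along the subsequence \<open>r\<close>: the energy of
  \<open>F - hermite_partial a n\<close> is at most the limit inferior of the energies of
  differences of partial sums, hence at most the tail \<open>\<tau> n\<close> of the coefficient
  series.\<close>

lemma hermite_expansion_pointwise:
  assumes a: "summable (\<lambda>k. (cmod (a k))\<^sup>2)" and F [measurable]: "F \<in> borel_measurable borel"
    and r: "strict_mono r" and lim: "AE x in lborel. (\<lambda>i. hermite_partial a (r i) x) \<longlonglongrightarrow> F x"
  shows "hermite_expansion a F"
proof -
  define \<tau> where "\<tau> n = (\<Sum>k. (cmod (a (k + n)))\<^sup>2)" for n
  have [measurable]: "hermite_partial a n \<in> borel_measurable borel" for n
    by (intro L2_measurable L2_hermite_partial)
  have \<tau>0: "0 \<le> \<tau> n" for n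
    unfolding \<tau>_def using summable_ignore_initial_segment[OF a] by (intro suminf_nonneg) simp_all
  have \<tau>: "L2_energy (\<lambda>x. hermite_partial a m x - hermite_partial a n x) \<le> \<tau> n" if "n \<le> m" for m n
  proof -
    have "L2_energy (\<lambda>x. hermite_partial a m x - hermite_partial a n x) = (\<Sum>k\<in>{n..<m}. (cmod (a k))\<^sup>2)"
      by (simp add: hermite_partial_diff[OF that] L2_energy_sum_hermite)
    also have "\<dots> = (\<Sum>k<m - n. (cmod (a (k + n)))\<^sup>2)"
      using sum.shift_bounds_nat_ivl[of "\<lambda>k. (cmod (a k))\<^sup>2" 0 n "m - n"] that by (simp add: atLeast0LessThan)
    also have "\<dots> \<le> \<tau> n"
      unfolding \<tau>_def using summable_ignore_initial_segment[OF a] by (intro sum_le_suminf) simp_all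
    finally show ?thesis .
  qed
  have bound: "(\<integral>\<^sup>+x. ennreal ((cmod (F x - hermite_partial a n x))\<^sup>2) \<partial>lborel) \<le> ennreal (\<tau> n)" for n
  proof -
    let ?g = "\<lambda>i x. ennreal ((cmod (hermite_partial a (r i) x - hermite_partial a n x))\<^sup>2)"
    have "(\<integral>\<^sup>+x. ennreal ((cmod (F x - hermite_partial a n x))\<^sup>2) \<partial>lborel) = (\<integral>\<^sup>+x. liminf (\<lambda>i. ?g i x) \<partial>lborel)"
    proof (rule nn_integral_cong_AE, use lim in eventually_elim)
      case (elim x)
      then have "(\<lambda>i. ?g i x) \<longlonglongrightarrow> ennreal ((cmod (F x - hermite_partial a n x))\<^sup>2)"
        by (intro tendsto_intros)
      then show ?case by (rule lim_imp_Liminf[OF sequentially_bot, symmetric])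
    qed
    also have "\<dots> \<le> liminf (\<lambda>i. \<integral>\<^sup>+x. ?g i x \<partial>lborel)"
      by (rule nn_integral_liminf) measurable
    also have "\<dots> \<le> liminf (\<lambda>i. ennreal (\<tau> n))"
    proof (rule Liminf_mono)
      have "(\<integral>\<^sup>+x. ?g i x \<partial>lborel) \<le> ennreal (\<tau> n)" if "i \<ge> n" for i
      proof -
        have "(\<integral>\<^sup>+x. ?g i x \<partial>lborel) = ennreal (L2_energy (\<lambda>x. hermite_partial a (r i) x - hermite_partial a n x))"
          by (intro nn_integral_L2 L2_diff L2_hermite_partial)
        also have "\<dots> \<le> ennreal (\<tau> n)"
          using seq_suble[OF r, of i] that by (intro ennreal_leI \<tau>) linarith
        finally show ?thesis .
      qed
      then show "\<forall>\<^sub>F i in sequentially. (\<integral>\<^sup>+x. ?g i x \<partial>lborel) \<le> ennreal (\<tau> n)"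
        by (auto simp: eventually_sequentially)
    qed
    also have "\<dots> = ennreal (\<tau> n)" by (simp add: Liminf_const)
    finally show ?thesis .
  qed
  have "(\<lambda>x. F x - hermite_partial a n x) \<in> L2" "L2_energy (\<lambda>x. F x - hermite_partial a n x) \<le> \<tau> n" for n
    using bound[of n] \<tau>0[of n] by (auto intro!: L2_I)
  note * = this
  have "F \<in> L2" using *(1)[of 0] by (simp add: hermite_partial_def)
  moreover have "\<tau> \<longlonglongrightarrow> 0"
    unfolding \<tau>_def using a by (rule suminf_exist_split2)
  then have "(\<lambda>n. L2_energy (\<lambda>x. F x - hermite_partial a n x)) \<longlonglongrightarrow> 0"
    by (rule tendsto_sandwich[OF _ _ tendsto_const, rotated 2]) (simp_all add: L2_energy_nonneg *(2))
  ultimately show ?thesis by (simp add: hermite_expansion_iff)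
qed

text \<open>The integral of the sum of squares is the sum of the energies, so the sum is finite
  almost everywhere. Summable energies thereby give pointwise convergence of the terms to
  zero.\<close>

lemma AE_summable_L2:
  assumes f: "\<And>i. f i \<in> L2" and "summable (\<lambda>i. L2_energy (f i))"
  shows "AE x in lborel. summable (\<lambda>i. (cmod (f i x))\<^sup>2)"
proof -
  have [measurable]: "f i \<in> borel_measurable borel" for i using f by (rule L2_measurable)
  have "(\<integral>\<^sup>+x. (\<Sum>i. ennreal ((cmod (f i x))\<^sup>2)) \<partial>lborel) = (\<Sum>i. ennreal (L2_energy (f i)))"
    by (subst nn_integral_suminf) (simp_all add: nn_integral_L2[OF f])
  also have "\<dots> \<noteq> \<infinity>"
    using assms(2) L2_energy_nonneg by (metis ennreal_suminf_neq_top infinity_ennreal_def)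
  finally have "AE x in lborel. (\<Sum>i. ennreal ((cmod (f i x))\<^sup>2)) \<noteq> \<infinity>"
    by (intro nn_integral_PInf_AE) auto
  then show ?thesis
    by eventually_elim (auto intro: summable_suminf_not_top)
qed

text \<open>The Riesz-Fischer theorem: a subsequence of the partial sums that converges fast enough
  in energy converges almost everywhere, and its limit has the given coefficients.\<close>

lemma hermite_expansion_exists:
  assumes a: "summable (\<lambda>k. (cmod (a k))\<^sup>2)"
  shows "\<exists>F. hermite_expansion a F"
proof -
  define s where "s n = (\<Sum>k<n. (cmod (a k))\<^sup>2)" for n
  have "Cauchy s"
    using a unfolding s_def by (simp add: Cauchy_convergent_iff summable_iff_convergent)
  \<comment> \<open>The rate \<open>1/8\<close> leaves room for the weights \<open>2 ^ i\<close>
    below: they multiply energies by \<open>4 ^ i\<close>, and \<open>(4/8) ^ i\<close> is still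
    summable.\<close>
  then have "\<exists>N. \<forall>m\<ge>N. \<forall>n\<ge>N. \<bar>s m - s n\<bar> < (1/8) ^ i" for i :: nat
    unfolding Cauchy_def dist_real_def by simp
  then obtain N where N: "\<And>i m n. m \<ge> N i \<Longrightarrow> n \<ge> N i \<Longrightarrow> \<bar>s m - s n\<bar> < (1/8) ^ i"
    by metis
  \<comment> \<open>\<open>Suc ri\<close> forces strict growth; \<open>N (Suc i)\<close> keeps the
    index beyond the Cauchy threshold.\<close>
  define r where "r = rec_nat (N 0) (\<lambda>i ri. max (Suc ri) (N (Suc i)))"
  have r_simps: "r 0 = N 0" "r (Suc i) = max (Suc (r i)) (N (Suc i))" for i
    by (simp_all add: r_def)
  have r: "strict_mono r" by (auto simp: strict_mono_Suc_iff r_simps)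
  have rN: "N i \<le> r i" for i by (cases i) (auto simp: r_simps)
  define D where "D i x = hermite_partial a (r (Suc i)) x - hermite_partial a (r i) x" for i x
  have DL2: "D i \<in> L2" for i unfolding D_def[abs_def] by (intro L2_diff L2_hermite_partial)
  have DE: "L2_energy (D i) \<le> (1/8) ^ i" for i
  proof -
    have le: "r i \<le> r (Suc i)" by (simp add: r_simps)
    have "L2_energy (D i) = (\<Sum>k\<in>{r i..<r (Suc i)}. (cmod (a k))\<^sup>2)"
      unfolding D_def[abs_def] by (simp add: hermite_partial_diff[OF le] L2_energy_sum_hermite)
    also have "\<dots> = s (r (Suc i)) - s (r i)"
      unfolding s_def by (metis sum_diff_nat_ivl atLeast0LessThan le zero_le)
    also have "\<dots> \<le> (1/8) ^ i"
      using N[of i "r (Suc i)" "r i"] rN[of i] le by simp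
    finally show ?thesis .
  qed
  have "AE x in lborel. summable (\<lambda>i. (cmod (2 ^ i * D i x))\<^sup>2)"
  proof (rule AE_summable_L2)
    show "(\<lambda>x. 2 ^ i * D i x) \<in> L2" for i by (intro L2_cmult DL2)
    have "L2_energy (\<lambda>x. 2 ^ i * D i x) \<le> (1/2) ^ i" for i
    proof -
      have "L2_energy (\<lambda>x. 2 ^ i * D i x) = 4 ^ i * L2_energy (D i)"
        by (simp add: L2_energy_cmult norm_power power_mult[symmetric] mult.commute[of i])
           (simp add: power_mult)
      also have "\<dots> \<le> 4 ^ i * (1/8) ^ i" using DE[of i] by (intro mult_left_mono) auto
      also have "\<dots> = (1/2) ^ i" by (simp flip: power_mult_distrib)
      finally show ?thesis .
    qed
    then show "summable (\<lambda>i. L2_energy (\<lambda>x. 2 ^ i * D i x))"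
      by (intro summable_comparison_test[OF _ summable_geometric[of "1/2::real"]])
         (auto simp: L2_energy_nonneg)
  qed
  then have conv: "AE x in lborel. convergent (\<lambda>i. hermite_partial a (r i) x)"
  proof eventually_elim
    case (elim x)
    \<comment> \<open>Once the weighted term is below 1, \<open>D i x\<close> is bounded by
      \<open>(1/2) ^ i\<close>; the telescoping series then converges absolutely.\<close>
    then have "(\<lambda>i. (cmod (2 ^ i * D i x))\<^sup>2) \<longlonglongrightarrow> 0" by (rule summable_LIMSEQ_zero)
    then have "\<forall>\<^sub>F i in sequentially. (cmod (2 ^ i * D i x))\<^sup>2 < 1" by (rule order_tendstoD) auto
    then have "\<forall>\<^sub>F i in sequentially. cmod (D i x) \<le> (1/2) ^ i"
    proof eventually_elim
      case (elim i)
      then have "cmod (2 ^ i * D i x) \<le> 1" by (simp add: power_less_one_iff abs_square_less_1 less_imp_le)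
      then show ?case by (simp add: norm_mult norm_power field_simps)
    qed
    then have "summable (\<lambda>i. D i x)"
      by (rule summable_comparison_test_ev) (simp add: summable_geometric)
    then have "convergent (\<lambda>n. \<Sum>i<n. D i x)" by (simp add: summable_iff_convergent)
    then have "convergent (\<lambda>n. hermite_partial a (r n) x - hermite_partial a (r 0) x)"
      using sum_lessThan_telescope[of "\<lambda>n. hermite_partial a (r n) x"] by (simp add: D_def)
    from convergent_add[OF this convergent_const[of "hermite_partial a (r 0) x"]]
    show ?case by simp
  qed
  have [measurable]: "hermite_partial a n \<in> borel_measurable borel" for n
    by (intro L2_measurable L2_hermite_partial)
  define F where "F x = lim (\<lambda>i. hermite_partial a (r i) x)" for x
  have "hermite_expansion a F"
  proof (rule hermite_expansion_pointwise[OF a _ r])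
    show "F \<in> borel_measurable borel" unfolding F_def[abs_def] by (rule borel_measurable_lim_metric) measurable
    show "AE x in lborel. (\<lambda>i. hermite_partial a (r i) x) \<longlonglongrightarrow> F x"
      using conv by eventually_elim (simp add: F_def convergent_LIMSEQ_iff)
  qed
  then show ?thesis by (intro exI[of _ F])
qed

subsection \<open>Coherent states\<close>

definition hermite_phase :: "real \<Rightarrow> nat \<Rightarrow> complex" where
  "hermite_phase t k = exp (- \<i> * complex_of_real t * complex_of_real (2 * real k + 1))"

text \<open>
  Up to the phase \<open>(- \<i>) ^ k\<close>, these are the coefficients of the generating function at
  \<open>z = - \<i> p / sqrt 2\<close>, scaled so that the wave packet has height \<open>1\<close>.
\<close>

definition coherent_amp :: "real \<Rightarrow> nat \<Rightarrow> real" where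
  "coherent_amp p k = pi powr (1/4) * exp (- p\<^sup>2 / 4) * (p / sqrt 2) ^ k / sqrt (fact k)"

text \<open>Closed form of the evolved coherent state: the phase of the ground state, a Gaussian
  about the classical position \<open>p * sin (2 * t)\<close>, and an oscillation with the classical
  momentum \<open>p * cos (2 * t)\<close>.\<close>

definition coherent_wave :: "real \<Rightarrow> real \<Rightarrow> real \<Rightarrow> complex" where
  "coherent_wave p t x = exp (- \<i> * of_real t) *
     exp (of_real (- (x - p * sin (2 * t))\<^sup>2 / 2)) *
     cis (x * p * cos (2 * t) - p\<^sup>2 / 2 * sin (2 * t) * cos (2 * t))"

text \<open>Raising \<open>k\<close> by one multiplies the phase by \<open>exp (- 2 i t)\<close>.
  The evolution therefore only rotates the argument \<open>z\<close> of the generating function,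
  apart from a global phase.\<close>

lemma coherent_wave_sums:
  "(\<lambda>k. hermite_phase t k * ((- \<i>) ^ k * of_real (coherent_amp p k)) * of_real (hermite_fun k x))
     sums coherent_wave p t x"
proof -
  define E where "E = exp (- (2 * \<i> * complex_of_real t))"
  define z where "z = - \<i> * of_real p / of_real (sqrt 2) * E"
  define A where "A = exp (- \<i> * complex_of_real t) * of_real (pi powr (1/4) * exp (- p\<^sup>2 / 4))"
  have phase: "hermite_phase t k = exp (- \<i> * complex_of_real t) * E ^ k" for k
    unfolding hermite_phase_def E_def exp_of_nat_mult[symmetric] exp_add[symmetric]
    by (simp add: algebra_simps)
  have E: "E = of_real (cos (2 * t)) - \<i> * of_real (sin (2 * t))"
    using cis_conv_exp[of "- (2 * t)"] unfolding E_def by (simp add: complex_eq_iff algebra_simps)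
  have coeff_eq: "A * (z ^ k / of_real (sqrt (fact k)) * of_real (hermite_fun k x)) =
    hermite_phase t k * ((- \<i>) ^ k * of_real (coherent_amp p k)) * of_real (hermite_fun k x)" for k
    unfolding phase A_def z_def coherent_amp_def power_mult_distrib power_divide of_real_mult of_real_divide of_real_power
    by (simp only: times_divide_eq_right times_divide_eq_left divide_divide_eq_left mult_ac)
  have s2: "complex_of_real (sqrt 2) * complex_of_real (sqrt 2) = 2" by (simp flip: of_real_mult)
  have z1: "of_real (sqrt 2) * of_real x * z = - \<i> * of_real (x * p) * E"
    unfolding z_def by simp
  have z2: "z\<^sup>2 / 2 = - of_real (p\<^sup>2 / 4) * E\<^sup>2"
    unfolding z_def by (simp add: power_mult_distrib power_divide power2_eq_square[of "complex_of_real (sqrt 2)"] s2)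
  define S where "S = sin (2 * t)"
  define C where "C = cos (2 * t)"
  \<comment> \<open>With this identity \<open>- p^2 / 4\<close> and the real part of
    \<open>- z^2 / 2\<close> combine to \<open>- (p * S)^2 / 2\<close>, which completes the square
    in \<open>x - p * S\<close>.\<close>
  have "C * C = 1 - S * S"
    using sin_cos_squared_add[of "2 * t"] by (simp add: S_def C_def power2_eq_square)
  then have "p * p * (C * C) = p * p * (1 - S * S)" by simp
  then have expo: "- of_real (p\<^sup>2 / 4) + (- (complex_of_real x)\<^sup>2 / 2 - of_real (sqrt 2) * of_real x * z - z\<^sup>2 / 2) =
      of_real (- (x - p * sin (2 * t))\<^sup>2 / 2) +
      \<i> * of_real (x * p * cos (2 * t) - p\<^sup>2 / 2 * sin (2 * t) * cos (2 * t))"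
    unfolding z1 z2 E S_def[symmetric] C_def[symmetric]
    by (simp add: complex_eq_iff power2_eq_square field_simps)
  have "A * (of_real (pi powr (-1/4)) * exp (- (of_real x)\<^sup>2 / 2 - of_real (sqrt 2) * of_real x * z - z\<^sup>2 / 2))
    = exp (- \<i> * of_real t) * of_real (pi powr (1/4) * pi powr (-1/4)) *
      exp (- of_real (p\<^sup>2 / 4) + (- (complex_of_real x)\<^sup>2 / 2 - of_real (sqrt 2) * of_real x * z - z\<^sup>2 / 2))"
    unfolding A_def exp_add by (simp flip: exp_of_real)
  also have "\<dots> = coherent_wave p t x"
    unfolding expo coherent_wave_def exp_add cis_conv_exp
    by (simp flip: powr_add)
  finally show ?thesis
    using sums_mult[OF hermite_generating[of z x], of A] unfolding coeff_eq by simp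
qed

section \<open>Sobolev norm of a comb of coherent states\<close>

lemma coherent_amp_mult_sums:
  "(\<lambda>k. (\<beta> + \<gamma> * real k) * (coherent_amp p k * coherent_amp q k)) sums
    ((\<beta> + \<gamma> * (p * q / 2)) * (sqrt pi * exp (- (p - q)\<^sup>2 / 4)))"
proof -
  \<comment> \<open>The product of two amplitudes is \<open>A\<close> times a term of the
    exponential series at \<open>y\<close>, and an extra factor \<open>k\<close> contributes a
    factor \<open>y\<close> to the sum. The result decays like a Gaussian in \<open>p - q\<close>,
    which is the near orthogonality of the terms.\<close>
  define y where "y = p * q / 2"
  define A where "A = sqrt pi * exp (- (p\<^sup>2 + q\<^sup>2) / 4)"
  have exp: "(\<lambda>k. y ^ k / fact k) sums exp y"
    using exp_converges[of y] by (simp add: divide_inverse mult.commute)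
  have "(\<lambda>k. real (Suc k) * (y ^ Suc k / fact (Suc k))) sums (y * exp y)"
  proof -
    have "real (Suc k) * (y ^ Suc k / fact (Suc k)) = y * (y ^ k / fact k)" for k
      by (simp add: divide_simps del: of_nat_Suc)
    then show ?thesis using sums_mult[OF exp, of y] by simp
  qed
  from sums_Suc[OF this] have exp1: "(\<lambda>k. real k * (y ^ k / fact k)) sums (y * exp y)" by simp
  have "(\<lambda>k. A * (\<beta> * (y ^ k / fact k) + \<gamma> * (real k * (y ^ k / fact k)))) sums
      (A * (\<beta> * exp y + \<gamma> * (y * exp y)))"
    by (intro sums_mult sums_add exp exp1)
  moreover have "A * (\<beta> * (y ^ k / fact k) + \<gamma> * (real k * (y ^ k / fact k))) =
      (\<beta> + \<gamma> * real k) * (coherent_amp p k * coherent_amp q k)" for k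
  proof -
    have "coherent_amp p k * coherent_amp q k =
      (pi powr (1/4) * pi powr (1/4)) * (exp (- p\<^sup>2 / 4) * exp (- q\<^sup>2 / 4)) * ((p / sqrt 2) ^ k * (q / sqrt 2) ^ k)
        / (sqrt (fact k) * sqrt (fact k))"
      by (simp add: coherent_amp_def)
    also have "pi powr (1/4) * pi powr (1/4) = sqrt pi"
      by (simp add: powr_half_sqrt flip: powr_add)
    also have "exp (- p\<^sup>2 / 4) * exp (- q\<^sup>2 / 4) = exp (- (p\<^sup>2 + q\<^sup>2) / 4)"
      unfolding exp_add[symmetric] by (simp add: field_simps)
    also have "(p / sqrt 2) ^ k * (q / sqrt 2) ^ k = y ^ k"
      by (simp add: y_def flip: power_mult_distrib)
    also have "sqrt (fact k) * sqrt (fact k) = fact k" by simp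
    finally show ?thesis by (simp add: A_def algebra_simps add_divide_distrib)
  qed
  moreover have "A * (\<beta> * exp y + \<gamma> * (y * exp y)) = (\<beta> + \<gamma> * (p * q / 2)) * (sqrt pi * exp (- (p - q)\<^sup>2 / 4))"
  proof -
    have "exp (- (p - q)\<^sup>2 / 4) = exp (- (p\<^sup>2 + q\<^sup>2) / 4) * exp y"
      unfolding exp_add[symmetric] y_def by (simp add: power2_diff field_simps)
    then show ?thesis by (simp add: A_def y_def algebra_simps)
  qed
  ultimately show ?thesis by simp
qed

lemma sum_gaussian_le:
  "(\<Sum>m<N. \<Sum>n<N. exp (- (real m - real n)\<^sup>2 / 4)) \<le> 9 * real N"
proof -
  have exp_le: "exp (- (real m - real n)\<^sup>2 / 4) \<le> 3 * (1/2) ^ (nat \<bar>int m - int n\<bar>)" for m n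
  proof -
    define d where "d = nat \<bar>int m - int n\<bar>"
    have "(real m - real n)\<^sup>2 = (real d)\<^sup>2" by (simp add: d_def power2_abs)
    \<comment> \<open>\<open>d\<^sup>2 / 4 \<ge> d - 1\<close> reduces the Gaussian sum to a geometric one\<close>
    moreover have "0 \<le> (real d / 2 - 1)\<^sup>2" by simp
    then have "- (real d)\<^sup>2 / 4 \<le> 1 + real d * (-1)"
      by (simp add: power2_eq_square field_simps)
    then have "exp (- (real d)\<^sup>2 / 4) \<le> exp 1 * exp (-1) ^ d"
      by (simp add: exp_of_nat_mult[symmetric] exp_add[symmetric])
    also have "\<dots> \<le> 3 * (1/2) ^ d"
    proof (intro mult_mono power_mono exp_le)
      have "(2::real) \<le> exp 1" using exp_ge_add_one_self[of 1] by simp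
      then show "exp (-1) \<le> (1/2 :: real)" by (simp add: exp_minus field_simps)
    qed auto
    ultimately show ?thesis by (simp add: d_def)
  qed
  have geo: "(\<Sum>m<N. (1/2) ^ (N - m)) \<le> (1 :: real)" for N
  proof (induction N)
    case (Suc N)
    have "(\<Sum>m<Suc N. (1/2) ^ (Suc N - m)) = (\<Sum>m<N. (1/2) * (1/2) ^ (N - m)) + (1/2 :: real)"
      by (simp add: Suc_diff_le)
    also have "\<dots> = (1/2) * (\<Sum>m<N. (1/2) ^ (N - m)) + 1/2"
      by (simp only: sum_distrib_left)
    finally show ?case using Suc by simp
  qed simp
  \<comment> \<open>A new index adds a row and a column, each of sum at most 1 by
    \<open>geo\<close>, and the diagonal entry 1.\<close>
  have "(\<Sum>m<N. \<Sum>n<N. (1/2) ^ (nat \<bar>int m - int n\<bar>)) \<le> (3 :: real) * real N"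
  proof (induction N)
    case (Suc N)
    have 1: "(\<Sum>m<N. (1/2) ^ (nat \<bar>int m - int N\<bar>)) = (\<Sum>m<N. (1/2 :: real) ^ (N - m))"
      by (rule sum.cong) (auto simp: nat_diff_distrib' abs_if)
    have 2: "(\<Sum>m<N. (1/2) ^ (nat \<bar>int N - int m\<bar>)) = (\<Sum>m<N. (1/2 :: real) ^ (N - m))"
      by (rule sum.cong) (auto simp: nat_diff_distrib' abs_if)
    have "(\<Sum>m<Suc N. \<Sum>n<Suc N. (1/2) ^ (nat \<bar>int m - int n\<bar>)) =
      (\<Sum>m<N. \<Sum>n<N. (1/2) ^ (nat \<bar>int m - int n\<bar>)) + (\<Sum>m<N. (1/2) ^ (N - m)) + (\<Sum>m<N. (1/2) ^ (N - m)) + (1 :: real)"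
      unfolding sum.lessThan_Suc sum.distrib 1 2 by simp
    then show ?case using Suc geo[of N] by simp
  qed simp
  then have "(\<Sum>m<N. \<Sum>n<N. 3 * (1/2) ^ (nat \<bar>int m - int n\<bar>)) \<le> (9 :: real) * real N"
    by (simp flip: sum_distrib_left)
  moreover have "(\<Sum>m<N. \<Sum>n<N. exp (- (real m - real n)\<^sup>2 / 4)) \<le>
    (\<Sum>m<N. \<Sum>n<N. 3 * (1/2) ^ (nat \<bar>int m - int n\<bar>))"
    by (intro sum_mono exp_le)
  ultimately show ?thesis by simp
qed

definition packet_coeff :: "nat \<Rightarrow> nat \<Rightarrow> nat \<Rightarrow> complex" where
  "packet_coeff R N k = (\<Sum>m<N. (- \<i>) ^ k * of_real (coherent_amp (real (R + m)) k))"

definition packet_wave :: "nat \<Rightarrow> nat \<Rightarrow> real \<Rightarrow> real \<Rightarrow> complex" where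
  "packet_wave R N t x = (\<Sum>m<N. coherent_wave (real (R + m)) t x)"

lemma packet_wave_sums:
  "(\<lambda>k. hermite_phase t k * packet_coeff R N k * of_real (hermite_fun k x)) sums packet_wave R N t x"
  unfolding packet_coeff_def packet_wave_def sum_distrib_left sum_distrib_right
  by (intro sums_sum coherent_wave_sums)

lemma cmod_packet_coeff: "cmod (packet_coeff R N k) = \<bar>\<Sum>m<N. coherent_amp (real (R + m)) k\<bar>"
  by (simp add: packet_coeff_def norm_mult norm_power flip: sum_distrib_left of_real_sum)

text \<open>Serves to replace a power of the eigenvalue by an affine weight, for which
  \<open>coherent_amp_mult_sums\<close> gives an explicit sum.\<close>

lemma powr_le_one_add:
  fixes y a :: real
  assumes "0 \<le> y" "0 \<le> a" "a \<le> 1"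
  shows "y powr a \<le> 1 + y"
proof (cases "y \<le> 1")
  case True
  then have "y powr a \<le> 1" using assms by (intro powr_le1) auto
  then show ?thesis using assms by simp
next
  case False
  then have "y powr a \<le> y powr 1" using assms by (intro powr_mono) auto
  then show ?thesis using False by simp
qed

text \<open>The relevant eigenvalues are of order \<open>R^2\<close>. After extraction of
  \<open>R powr (2 * a)\<close> the weight is \<open>((2 * k + 1) / R^2) powr a\<close>, at most the
  affine \<open>\<beta> + \<gamma> * k\<close>; the affine sum then reduces to
  \<open>sum_gaussian_le\<close>.\<close>

lemma packet_coeff_weighted_le:
  assumes N: "1 \<le> N" "N \<le> R" and a: "0 \<le> a" "a \<le> 1"
  shows "(\<Sum>k<n. ((2 * real k + 1) powr (a / 2) * cmod (packet_coeff R N k))\<^sup>2) \<le> 108 * real N * real R powr (2 * a)"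
proof -
  let ?S = "\<lambda>k. \<Sum>m<N. coherent_amp (real (R + m)) k"
  have R: "0 < real R" using N by simp
  define \<beta> where "\<beta> = 1 + 1 / (real R)\<^sup>2"
  define \<gamma> where "\<gamma> = 2 / (real R)\<^sup>2"
  define V where "V = (\<Sum>m<N. \<Sum>m'<N. (\<beta> + \<gamma> * (real (R + m) * real (R + m') / 2)) *
      (sqrt pi * exp (- (real (R + m) - real (R + m'))\<^sup>2 / 4)))"
  have pos: "0 \<le> \<beta>" "0 \<le> \<gamma>" by (simp_all add: \<beta>_def \<gamma>_def)
  have sums: "(\<lambda>k. (\<beta> + \<gamma> * real k) * (?S k)\<^sup>2) sums V"
  proof -
    have "(\<lambda>k. \<Sum>m<N. \<Sum>m'<N. (\<beta> + \<gamma> * real k) * (coherent_amp (real (R + m)) k * coherent_amp (real (R + m')) k)) sums V"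
      unfolding V_def by (intro sums_sum coherent_amp_mult_sums)
    moreover have "(\<Sum>m<N. \<Sum>m'<N. (\<beta> + \<gamma> * real k) * (coherent_amp (real (R + m)) k * coherent_amp (real (R + m')) k))
        = (\<beta> + \<gamma> * real k) * (?S k)\<^sup>2" for k
      unfolding power2_eq_square sum_product by (simp only: sum_distrib_left)
    ultimately show ?thesis by simp
  qed
  \<comment> \<open>All momenta lie below \<open>2 * R\<close> because \<open>N \<le> R\<close>. The
    affine factor is thus at most \<open>2 + 4\<close>, \<open>sqrt pi\<close> is at most 2, and
    \<open>6 * 2 * 9 = 108\<close>.\<close>
  have "V \<le> (\<Sum>m<N. \<Sum>m'<N. 6 * (2 * exp (- (real m - real m')\<^sup>2 / 4)))"
    unfolding V_def
  proof (intro sum_mono mult_mono)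
    fix m m' assume "m \<in> {..<N}" "m' \<in> {..<N}"
    then have "real (R + m) * real (R + m') \<le> (2 * real R) * (2 * real R)"
      using N by (intro mult_mono) auto
    then have "\<gamma> * (real (R + m) * real (R + m') / 2) \<le> \<gamma> * ((2 * real R) * (2 * real R) / 2)"
      by (intro mult_left_mono divide_right_mono) (auto simp: \<gamma>_def)
    also have "\<dots> = 4" using R by (simp add: \<gamma>_def power2_eq_square)
    finally have "\<gamma> * (real (R + m) * real (R + m') / 2) \<le> 4" .
    moreover have "1 / (real R)\<^sup>2 \<le> 1" using N by (simp add: field_simps)
    ultimately show "\<beta> + \<gamma> * (real (R + m) * real (R + m') / 2) \<le> 6" by (simp add: \<beta>_def)
    show "sqrt pi \<le> 2" using pi_less_4 by (simp add: real_le_lsqrt)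
  qed auto
  also have "\<dots> = 12 * (\<Sum>m<N. \<Sum>m'<N. exp (- (real m - real m')\<^sup>2 / 4))"
    by (simp add: sum_distrib_left)
  also have "\<dots> \<le> 108 * real N" using sum_gaussian_le[of N] by simp
  finally have V: "V \<le> 108 * real N" .
  have "(\<Sum>k<n. ((2 * real k + 1) powr (a / 2) * cmod (packet_coeff R N k))\<^sup>2) \<le>
      (\<Sum>k<n. real R powr (2 * a) * ((\<beta> + \<gamma> * real k) * (?S k)\<^sup>2))"
  proof (intro sum_mono)
    fix k
    have "((2 * real k + 1) powr (a / 2))\<^sup>2 = (2 * real k + 1) powr a"
      by (simp add: power2_eq_square flip: powr_add)
    also have "\<dots> = ((real R)\<^sup>2 * ((2 * real k + 1) / (real R)\<^sup>2)) powr a" using R by simp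
    also have "\<dots> = real R powr (2 * a) * ((2 * real k + 1) / (real R)\<^sup>2) powr a"
      using R by (subst powr_mult) (auto simp: powr_powr simp flip: powr_numeral)
    also have "\<dots> \<le> real R powr (2 * a) * (1 + (2 * real k + 1) / (real R)\<^sup>2)"
      using a by (intro mult_left_mono powr_le_one_add) auto
    also have "1 + (2 * real k + 1) / (real R)\<^sup>2 = \<beta> + \<gamma> * real k"
      by (simp add: \<beta>_def \<gamma>_def add_divide_distrib)
    finally have "((2 * real k + 1) powr (a / 2))\<^sup>2 * (?S k)\<^sup>2 \<le> real R powr (2 * a) * (\<beta> + \<gamma> * real k) * (?S k)\<^sup>2"
      by (intro mult_right_mono) auto
    then show "((2 * real k + 1) powr (a / 2) * cmod (packet_coeff R N k))\<^sup>2 \<le> real R powr (2 * a) * ((\<beta> + \<gamma> * real k) * (?S k)\<^sup>2)"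
      by (simp add: cmod_packet_coeff power_mult_distrib mult.assoc)
  qed
  also have "\<dots> = real R powr (2 * a) * (\<Sum>k<n. (\<beta> + \<gamma> * real k) * (?S k)\<^sup>2)"
    by (simp add: sum_distrib_left)
  also have "\<dots> \<le> real R powr (2 * a) * V"
    unfolding sums_unique[OF sums]
    using pos by (intro mult_left_mono sum_le_suminf sums_summable[OF sums]) auto
  also have "\<dots> \<le> real R powr (2 * a) * (108 * real N)" using V by (intro mult_left_mono) auto
  finally show ?thesis by (simp add: mult_ac)
qed

section \<open>Pointwise size of a comb\<close>

lemma norm_coherent_wave: "cmod (coherent_wave p t x) = exp (- (x - p * sin (2 * t))\<^sup>2 / 2)"
  by (simp add: coherent_wave_def norm_mult norm_exp_eq_Re)

lemma norm_packet_wave_le: "cmod (packet_wave R N t x) \<le> real N"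
proof -
  have "cmod (packet_wave R N t x) \<le> (\<Sum>m<N. 1)"
    unfolding packet_wave_def by (intro sum_norm_le) (simp add: norm_coherent_wave)
  then show ?thesis by simp
qed

text \<open>Every centre has modulus at least \<open>R * \<bar>sin (2 * t)\<bar>\<close>, hence
  distance at least half of that from \<open>x\<close>. The Gaussian is weakened to an inverse
  square through \<open>y \<le> exp y\<close>.\<close>

lemma norm_packet_wave_decay:
  assumes "2 * \<bar>x\<bar> \<le> real R * \<bar>sin (2 * t)\<bar>" "sin (2 * t) \<noteq> 0" "0 < R"
  shows "cmod (packet_wave R N t x) \<le> real N * (8 / (real R * sin (2 * t))\<^sup>2)"
proof -
  define y where "y = real R * \<bar>sin (2 * t)\<bar>"
  have y: "0 < y" using assms by (simp add: y_def)
  have "cmod (coherent_wave (real (R + m)) t x) \<le> 8 / y\<^sup>2" for m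
  proof -
    have "y \<le> real (R + m) * \<bar>sin (2 * t)\<bar>" unfolding y_def by (intro mult_right_mono) auto
    then have "y \<le> \<bar>real (R + m) * sin (2 * t)\<bar>" by (simp add: abs_mult)
    then have "y / 2 \<le> \<bar>x - real (R + m) * sin (2 * t)\<bar>"
      using assms(1) unfolding y_def by linarith
    then have "(y / 2)\<^sup>2 \<le> (x - real (R + m) * sin (2 * t))\<^sup>2"
      using y by (metis abs_le_square_iff abs_of_nonneg divide_nonneg_nonneg less_imp_le zero_le_numeral)
    then have "cmod (coherent_wave (real (R + m)) t x) \<le> exp (- (y\<^sup>2 / 8))"
      by (simp add: norm_coherent_wave power_divide)
    also have "\<dots> = 1 / exp (y\<^sup>2 / 8)" by (simp add: exp_minus field_simps)
    also have "\<dots> \<le> 1 / (y\<^sup>2 / 8)"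
    proof (intro divide_left_mono)
      show "y\<^sup>2 / 8 \<le> exp (y\<^sup>2 / 8)" using exp_ge_add_one_self[of "y\<^sup>2 / 8"] by linarith
    qed (use y in auto)
    finally show ?thesis by simp
  qed
  then have "cmod (packet_wave R N t x) \<le> (\<Sum>m<N. 8 / y\<^sup>2)"
    unfolding packet_wave_def by (intro sum_norm_le) auto
  then show ?thesis by (simp add: y_def power_mult_distrib)
qed

text \<open>After removal of the common unimodular factor \<open>A\<close>, the offset
  \<open>m\<close> enters only through \<open>m * s\<close> and \<open>s * c * m^2\<close>. Both are
  small because \<open>\<bar>s\<bar> * N^2 \<le> 1/2\<close>, so every term has real part at least
  \<open>3/4\<close> and nothing cancels.\<close>

lemma norm_packet_wave_focus:
  assumes s: "sin (2 * t) = x / real R" and x: "2 * \<bar>x\<bar> * (real N)\<^sup>2 \<le> real R" and N: "1 \<le> N" "0 < R"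
  shows "3/4 * real N \<le> cmod (packet_wave R N t x)"
proof -
  define s where "s = sin (2 * t)"
  define c where "c = cos (2 * t)"
  define A where "A = exp (- \<i> * of_real t) * cis (s * c * (real R)\<^sup>2 / 2)"
  define g where "g m = exp (complex_of_real (- (real m * s)\<^sup>2 / 2)) * cis (- (s * c * (real m)\<^sup>2 / 2))" for m :: nat
  have xs: "x = real R * s" using s N by (simp add: s_def)
  have "2 * \<bar>s\<bar> * (real N)\<^sup>2 * real R \<le> 1 * real R"
    using x unfolding xs by (simp add: abs_mult mult_ac)
  then have sN: "\<bar>s\<bar> * (real N)\<^sup>2 \<le> 1/2" using N by simp
  have "coherent_wave (real (R + m)) t x = A * g m" for m
  proof -
    have 1: "x - real (R + m) * s = - (real m * s)" by (simp add: xs algebra_simps)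
    \<comment> \<open>The term \<open>R * m\<close> from \<open>x * (R + m)\<close> cancels the
      cross term of \<open>(R + m)^2 / 2\<close>.\<close>
    have 2: "x * real (R + m) * c - (real (R + m))\<^sup>2 / 2 * s * c = s * c * (real R)\<^sup>2 / 2 + - (s * c * (real m)\<^sup>2 / 2)"
      unfolding xs by (simp add: power2_eq_square field_simps)
    show ?thesis
      unfolding coherent_wave_def s_def[symmetric] c_def[symmetric] 1 2 A_def g_def cis_mult[symmetric]
      by simp
  qed
  then have "cmod (packet_wave R N t x) = cmod A * cmod (\<Sum>m<N. g m)"
    by (simp add: packet_wave_def norm_mult flip: sum_distrib_left)
  also have "cmod A = 1" by (simp add: A_def norm_mult norm_exp_eq_Re)
  finally have "cmod (packet_wave R N t x) \<ge> Re (\<Sum>m<N. g m)"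
    using complex_Re_le_cmod[of "\<Sum>m<N. g m"] by simp
  moreover have "(\<Sum>m<N. 3/4) \<le> (\<Sum>m<N. Re (g m))"
  proof (intro sum_mono)
    fix m assume "m \<in> {..<N}"
    then have m: "real m \<le> real N" "real m \<le> (real N)\<^sup>2"
      using N self_le_power[of "real N" 2] by auto
    have "\<bar>s\<bar> * real m \<le> \<bar>s\<bar> * (real N)\<^sup>2" using m by (intro mult_left_mono) auto
    then have ms: "\<bar>real m * s\<bar> \<le> 1/2" using sN by (simp add: abs_mult mult.commute)
    then have "(real m * s)\<^sup>2 \<le> (1/2)\<^sup>2" by (metis abs_le_square_iff abs_of_pos half_gt_zero zero_less_one)
    then have e: "7/8 \<le> exp (- (real m * s)\<^sup>2 / 2)"
      using exp_ge_add_one_self[of "- (real m * s)\<^sup>2 / 2"] by (simp add: power2_eq_square)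
    define \<theta> where "\<theta> = s * c * (real m)\<^sup>2 / 2"
    have "\<bar>\<theta>\<bar> = \<bar>s\<bar> * \<bar>c\<bar> * (real m)\<^sup>2 / 2" by (simp add: \<theta>_def abs_mult)
    also have "\<dots> \<le> \<bar>s\<bar> * 1 * (real N)\<^sup>2 / 2"
      using m by (intro divide_right_mono mult_mono power_mono) (auto simp: c_def)
    also have "\<dots> \<le> 1/4" using sN by simp
    finally have "\<bar>\<theta>\<bar> \<le> 1/4" .
    then have "\<theta>\<^sup>2 \<le> (1/4)\<^sup>2" by (metis abs_le_square_iff abs_of_pos zero_less_divide_1_iff zero_less_numeral)
    moreover have "cos \<theta> \<ge> 1 - \<theta>\<^sup>2 / 2"
    proof -
      have "cos \<theta> = 1 - 2 * (sin (\<theta> / 2))\<^sup>2" using cos_double_sin[of "\<theta> / 2"] by simp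
      moreover have "(sin (\<theta> / 2))\<^sup>2 \<le> (\<theta> / 2)\<^sup>2"
        using abs_sin_x_le_abs_x[of "\<theta> / 2"] by (simp only: abs_le_square_iff)
      ultimately show ?thesis by (simp add: power_divide)
    qed
    ultimately have c: "7/8 \<le> cos \<theta>" by (simp add: power2_eq_square)
    have "3/4 \<le> (7/8) * (7/8 :: real)" by simp
    also have "\<dots> \<le> exp (- (real m * s)\<^sup>2 / 2) * cos \<theta>" using e c by (intro mult_mono) auto
    also have "\<dots> = Re (g m)" unfolding g_def \<theta>_def[symmetric] exp_of_real by simp
    finally show "3/4 \<le> Re (g m)" .
  qed
  ultimately show ?thesis by simp
qed

lemma continuous_on_packet_wave: "continuous_on A (\<lambda>t. packet_wave R N t x)"
  unfolding packet_wave_def coherent_wave_def cis_conv_exp by (intro continuous_intros) auto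

lemma borel_measurable_packet_wave [measurable]: "packet_wave R N t \<in> borel_measurable borel"
  unfolding packet_wave_def[abs_def] coherent_wave_def cis_conv_exp
  by (intro borel_measurable_continuous_onI continuous_intros) auto

subsection \<open>Superposition of the packets\<close>

text \<open>For momentum \<open>R = Suc j * N^2\<close> the weighted energy is a constant times
  \<open>N powr (4 * a - 1)\<close>; this is where the threshold \<open>1/4\<close> arises.\<close>

lemma packet_size_exists:
  fixes a :: real
  assumes a: "0 < a" "a < 1/4"
  shows "\<exists>N\<ge>M. (8 ^ j / real N)\<^sup>2 * (108 * real N * real (Suc j * N\<^sup>2) powr (2 * a)) \<le> (1/16) ^ j"
proof -
  define K where "K = 64 ^ j * 108 * real (Suc j) powr (2 * a)"
  have "((\<lambda>x::real. x powr (4 * a - 1)) \<longlongrightarrow> 0) at_top"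
    using a by (intro tendsto_neg_powr filterlim_ident) auto
  then have "((\<lambda>N. K * real N powr (4 * a - 1)) \<longlongrightarrow> K * 0) sequentially"
    by (intro tendsto_intros filterlim_compose[OF _ filterlim_real_sequentially])
  then have "\<forall>\<^sub>F N in sequentially. K * real N powr (4 * a - 1) < (1/16) ^ j"
    by (rule order_tendstoD) simp
  then have "\<forall>\<^sub>F N in sequentially. M \<le> N \<and> 1 \<le> N \<and> K * real N powr (4 * a - 1) < (1/16) ^ j"
    by (intro eventually_conj eventually_ge_at_top)
  then obtain N where N: "M \<le> N" "1 \<le> N" "K * real N powr (4 * a - 1) < (1/16) ^ j"
    by (metis (mono_tags, lifting) eventually_happens trivial_limit_sequentially)
  have X1: "real (Suc j * N\<^sup>2) powr (2 * a) = real (Suc j) powr (2 * a) * real N powr (4 * a)"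
  proof -
    have "real (Suc j * N\<^sup>2) = real (Suc j) * real N powr 2"
      using N(2) by (simp add: powr_numeral distrib_right)
    then show ?thesis by (simp only: powr_mult powr_powr of_nat_0_le_iff powr_ge_zero) simp
  qed
  have X2: "real N powr (4 * a - 1) = real N powr (4 * a) / real N"
    using N(2) by (simp add: powr_diff)
  have X3: "(8 ^ j / real N)\<^sup>2 * real N = 64 ^ j / real N"
    using N(2) by (simp add: power2_eq_square power_divide flip: power_mult_distrib)
  have "(8 ^ j / real N)\<^sup>2 * (108 * real N * real (Suc j * N\<^sup>2) powr (2 * a)) =
      108 * ((8 ^ j / real N)\<^sup>2 * real N) * real (Suc j * N\<^sup>2) powr (2 * a)"
    by (simp only: mult_ac)
  also have "\<dots> = K * real N powr (4 * a - 1)"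
    unfolding X1 X2 X3 K_def by simp
  finally have "(8 ^ j / real N)\<^sup>2 * (108 * real N * real (Suc j * N\<^sup>2) powr (2 * a)) = K * real N powr (4 * a - 1)" .
  with N show ?thesis by (intro exI[of _ N]) auto
qed

text \<open>The lower bound for \<open>N (Suc j)\<close> is known only once \<open>N j\<close> is
  chosen, hence dependent choice; \<open>packet_size_exists\<close> accepts any lower bound.\<close>

lemma packet_sizes_exist:
  fixes a :: real
  assumes a: "0 < a" "a < 1/4"
  obtains N :: "nat \<Rightarrow> nat" where "\<And>j. 4 ^ Suc j \<le> N j" "\<And>j. Suc j * (N j)\<^sup>2 \<le> N (Suc j)"
    "\<And>j. (8 ^ j / real (N j))\<^sup>2 * (108 * real (N j) * real (Suc j * (N j)\<^sup>2) powr (2 * a)) \<le> (1/16) ^ j"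
proof -
  let ?P = "\<lambda>j N. 4 ^ Suc j \<le> N \<and> (8 ^ j / real N)\<^sup>2 * (108 * real N * real (Suc j * N\<^sup>2) powr (2 * a)) \<le> (1/16) ^ j"
  have "\<exists>N. \<forall>j. ?P j (N j) \<and> Suc j * (N j)\<^sup>2 \<le> N (Suc j)"
  proof (rule dependent_nat_choice)
    show "\<exists>N. ?P 0 N" using packet_size_exists[OF a, of "4 ^ Suc 0" 0] by blast
  next
    fix N j
    show "\<exists>N'. ?P (Suc j) N' \<and> Suc j * N\<^sup>2 \<le> N'"
      using packet_size_exists[OF a, of "max (4 ^ Suc (Suc j)) (Suc j * N\<^sup>2)" "Suc j"] by auto
  qed
  then show thesis using that by blast
qed

text \<open>The norms are at most \<open>(1/4) ^ j\<close>, so Minkowski's inequality on the first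
  \<open>n\<close> indices bounds finite tails by \<open>4/3 * (1/4) ^ J\<close>. The limit over the
  tail length is then taken with \<open>n\<close> fixed.\<close>

lemma l2_geometric_series:
  fixes v :: "nat \<Rightarrow> nat \<Rightarrow> complex"
  assumes v: "\<And>j n. (\<Sum>k<n. (cmod (v j k))\<^sup>2) \<le> (1/16) ^ j"
  shows "summable (\<lambda>j. v j k)"
    and "(\<Sum>k<n. (cmod ((\<Sum>j. v j k) - (\<Sum>j<J. v j k)))\<^sup>2) \<le> 16/9 * (1/16) ^ J"
proof -
  have sq: "(1/16::real) ^ j = ((1/4) ^ j)\<^sup>2" for j
    by (simp add: power2_eq_square flip: power_mult_distrib)
  have "cmod (v j k) \<le> (1/4) ^ j" for j k
  proof (rule power2_le_imp_le)
    have "(cmod (v j k))\<^sup>2 \<le> (\<Sum>k<Suc k. (cmod (v j k))\<^sup>2)"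
      by (intro member_le_sum) auto
    also have "\<dots> \<le> (1/16) ^ j" by (rule v)
    finally show "(cmod (v j k))\<^sup>2 \<le> ((1/4) ^ j)\<^sup>2" by (simp add: sq)
  qed simp
  then show summable: "summable (\<lambda>j. v j k)" for k
    by (intro summable_comparison_test[OF _ summable_geometric[of "1/4::real"]]) auto
  have L2: "L2_set (\<lambda>k. cmod (v j k)) {..<n} \<le> (1/4) ^ j" for j
    unfolding L2_set_def using v[of j n] by (intro real_le_lsqrt) (auto simp: sq sum_nonneg)
  \<comment> \<open>The right-hand side is the exact partial sum of the geometric series, so that
    the induction closes.\<close>
  have tail: "L2_set (\<lambda>k. cmod (\<Sum>j\<in>{J..<J + i}. v j k)) {..<n} \<le> 4/3 * (1/4) ^ J * (1 - (1/4) ^ i)" for i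
  proof (induction i)
    case (Suc i)
    have "L2_set (\<lambda>k. cmod (\<Sum>j\<in>{J..<J + Suc i}. v j k)) {..<n} \<le>
        L2_set (\<lambda>k. cmod (\<Sum>j\<in>{J..<J + i}. v j k) + cmod (v (J + i) k)) {..<n}"
      by (intro L2_set_mono) (auto simp: norm_triangle_ineq)
    also have "\<dots> \<le> L2_set (\<lambda>k. cmod (\<Sum>j\<in>{J..<J + i}. v j k)) {..<n} + L2_set (\<lambda>k. cmod (v (J + i) k)) {..<n}"
      by (rule L2_set_triangle_ineq)
    also have "\<dots> \<le> 4/3 * (1/4) ^ J * (1 - (1/4) ^ i) + (1/4) ^ (J + i)"
      by (intro add_mono Suc.IH L2)
    also have "\<dots> = 4/3 * (1/4) ^ J * (1 - (1/4) ^ Suc i)"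
      by (simp add: power_add field_simps)
    finally show ?case .
  qed (simp add: L2_set_def)
  have "(\<Sum>k<n. (cmod ((\<Sum>j<J + i. v j k) - (\<Sum>j<J. v j k)))\<^sup>2) \<le> 16/9 * (1/16) ^ J" for i
  proof -
    let ?L = "L2_set (\<lambda>k. cmod (\<Sum>j\<in>{J..<J + i}. v j k)) {..<n}"
    have "(\<Sum>j<J + i. v j k) - (\<Sum>j<J. v j k) = (\<Sum>j\<in>{J..<J + i}. v j k)" for k
      using sum_diff_nat_ivl[of 0 J "J + i" "\<lambda>j. v j k"] by (simp add: atLeast0LessThan)
    then have "(\<Sum>k<n. (cmod ((\<Sum>j<J + i. v j k) - (\<Sum>j<J. v j k)))\<^sup>2) = ?L\<^sup>2"
      by (simp add: L2_set_def sum_nonneg)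
    also have "?L \<le> 4/3 * (1/4) ^ J"
      using tail[of i] by (rule order_trans) (simp add: mult_left_le)
    then have "?L\<^sup>2 \<le> (4/3 * (1/4) ^ J)\<^sup>2" by (intro power_mono) auto
    also have "\<dots> = 16/9 * (1/16) ^ J" by (simp add: sq power_mult_distrib power2_eq_square)
    finally show ?thesis .
  qed
  moreover have "(\<lambda>i. \<Sum>k<n. (cmod ((\<Sum>j<J + i. v j k) - (\<Sum>j<J. v j k)))\<^sup>2) \<longlonglongrightarrow>
      (\<Sum>k<n. (cmod ((\<Sum>j. v j k) - (\<Sum>j<J. v j k)))\<^sup>2)"
  proof (intro tendsto_intros)
    fix k
    have "(\<lambda>i. \<Sum>j<i + J. v j k) \<longlonglongrightarrow> (\<Sum>j. v j k)"
      using summable_LIMSEQ[OF summable[of k]] by (rule LIMSEQ_ignore_initial_segment)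
    then show "(\<lambda>i. \<Sum>j<J + i. v j k) \<longlonglongrightarrow> (\<Sum>j. v j k)" by (simp add: add.commute)
  qed
  ultimately show "(\<Sum>k<n. (cmod ((\<Sum>j. v j k) - (\<Sum>j<J. v j k)))\<^sup>2) \<le> 16/9 * (1/16) ^ J"
    by (intro LIMSEQ_le_const2) auto
qed

section \<open>Divergence of the superposition at focusing times\<close>

locale packet_sequence =
  fixes N :: "nat \<Rightarrow> nat"
  assumes N_ge: "4 ^ Suc j \<le> N j"
    and N_Suc: "Suc j * (N j)\<^sup>2 \<le> N (Suc j)"
begin

text \<open>The factor \<open>Suc j\<close> makes
  \<open>2 * \<bar>x\<bar> * (N j)^2 \<le> R j\<close> true eventually for every fixed
  \<open>x\<close>, as focusing requires.\<close>

definition R :: "nat \<Rightarrow> nat" where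
  "R j = Suc j * (N j)\<^sup>2"

definition packet_sum :: "nat \<Rightarrow> real \<Rightarrow> real \<Rightarrow> complex" where
  "packet_sum J t x = (\<Sum>j<J. of_real (8 ^ j / real (N j)) * packet_wave (R j) (N j) t x)"

lemma N_pos: "0 < N j"
  using N_ge[of j] by (rule less_le_trans[rotated]) simp

lemma N_ge_4: "4 \<le> N j"
proof -
  have "(4::nat) \<le> 4 ^ Suc j" by simp
  then show ?thesis using N_ge[of j] by linarith
qed

lemma R_pos: "0 < R j"
  using N_pos by (simp add: R_def)

lemma N_le_R: "N j \<le> R j"
proof -
  have "N j \<le> (N j)\<^sup>2" by (simp add: power2_eq_square)
  then show ?thesis by (simp add: R_def)
qed

lemma R_mono: "i \<le> j \<Longrightarrow> R i \<le> R j"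
proof (rule lift_Suc_mono_le[of R])
  show "R n \<le> R (Suc n)" for n
    using N_Suc[of n] N_le_R[of "Suc n"] by (simp add: R_def del: mult_Suc)
qed

text \<open>Separation of scales, from \<open>R j \<le> N i\<close> and
  \<open>N i * N i \<le> R i\<close>: when \<open>\<bar>sin (2 * t)\<bar>\<close> is of order
  \<open>\<bar>x\<bar> / R j\<close>, the centres of a later comb \<open>i\<close> have moved by at
  least the order of \<open>N i * \<bar>x\<bar>\<close>.\<close>

lemma N_mult_R_le:
  assumes "j < i"
  shows "N i * R j \<le> R i"
proof -
  obtain i' where i': "i = Suc i'" using assms by (cases i) auto
  have "R j \<le> R i'" using assms i' by (intro R_mono) auto
  also have "\<dots> \<le> N i" using N_Suc[of i'] by (simp add: i' R_def)
  finally have "N i * R j \<le> N i * N i" by (rule mult_left_mono) simp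
  also have "\<dots> \<le> R i" by (simp add: R_def power2_eq_square)
  finally show ?thesis .
qed

text \<open>Comb \<open>j\<close> contributes at least \<open>8 ^ j / 2\<close>, the earlier ones at
  most \<open>8 ^ j / 7\<close>, the later ones at most \<open>64 / x^2\<close>, and
  \<open>1/2 - 1/7 \<ge> 1/4\<close>. The bound is uniform in \<open>J\<close> and so survives the
  limit. The hypotheses leave slack against exact focusing, for the passage to rational
  times.\<close>

lemma norm_packet_sum_ge:
  assumes focus: "1/2 * real (N j) \<le> cmod (packet_wave (R j) (N j) t x)"
    and s: "\<bar>x\<bar> / (2 * real (R j)) \<le> \<bar>sin (2 * t)\<bar>" and x: "x \<noteq> 0" and J: "j < J"
  shows "8 ^ j / 4 - 64 / x\<^sup>2 \<le> cmod (packet_sum J t x)"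
proof -
  let ?w = "\<lambda>i. of_real (8 ^ i / real (N i)) * packet_wave (R i) (N i) t x"
  have norm_w: "cmod (?w i) = 8 ^ i / real (N i) * cmod (packet_wave (R i) (N i) t x)" for i
    by (simp add: norm_mult norm_divide norm_power)
  have "{..<J} = ({..<j} \<union> {j}) \<union> {j<..<J}" using J by auto
  then have "packet_sum J t x = sum ?w (({..<j} \<union> {j}) \<union> {j<..<J})"
    by (simp only: packet_sum_def)
  also have "\<dots> = sum ?w ({..<j} \<union> {j}) + sum ?w {j<..<J}"
    by (rule sum.union_disjoint) auto
  also have "sum ?w ({..<j} \<union> {j}) = sum ?w {..<j} + sum ?w {j}"
    by (rule sum.union_disjoint) auto
  finally have "packet_sum J t x = (\<Sum>i<j. ?w i) + ?w j + (\<Sum>i\<in>{j<..<J}. ?w i)"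
    by simp
  then have "cmod (?w j) - cmod (\<Sum>i<j. ?w i) - cmod (\<Sum>i\<in>{j<..<J}. ?w i) \<le> cmod (packet_sum J t x)"
    using norm_triangle_ineq4[of "packet_sum J t x - (\<Sum>i<j. ?w i)" "\<Sum>i\<in>{j<..<J}. ?w i"]
      norm_triangle_ineq4[of "packet_sum J t x" "\<Sum>i<j. ?w i"] by simp
  moreover have "8 ^ j / 2 \<le> cmod (?w j)"
  proof -
    have "8 ^ j / real (N j) * (1/2 * real (N j)) \<le> cmod (?w j)"
      unfolding norm_w by (intro mult_left_mono focus) auto
    then show ?thesis using N_pos[of j] by simp
  qed
  moreover have "cmod (\<Sum>i<j. ?w i) \<le> 8 ^ j / 7"
  proof -
    have "cmod (\<Sum>i<j. ?w i) \<le> (\<Sum>i<j. 8 ^ i)"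
    proof (rule sum_norm_le)
      fix i
      have "cmod (?w i) \<le> 8 ^ i / real (N i) * real (N i)"
        unfolding norm_w by (intro mult_left_mono norm_packet_wave_le) auto
      then show "cmod (?w i) \<le> 8 ^ i" using N_pos[of i] by simp
    qed
    also have "\<dots> = (8 ^ j - 1) / (7 :: real)" by (simp add: geometric_sum)
    finally show ?thesis by simp
  qed
  moreover have "cmod (\<Sum>i\<in>{j<..<J}. ?w i) \<le> 64 / x\<^sup>2"
  proof -
    have "cmod (\<Sum>i\<in>{j<..<J}. ?w i) \<le> (\<Sum>i\<in>{j<..<J}. 32 / x\<^sup>2 * (1/2) ^ i)"
    proof (rule sum_norm_le)
      fix i assume "i \<in> {j<..<J}"
      then have ij: "j < i" by simp
      have s0: "0 < \<bar>sin (2 * t)\<bar>"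
        using x R_pos[of j] by (intro less_le_trans[OF _ s]) simp
      have "real (N i) * \<bar>x\<bar> / 2 = real (N i * R j) * (\<bar>x\<bar> / (2 * real (R j)))"
        using R_pos[of j] by simp
      also have "\<dots> \<le> real (R i) * \<bar>sin (2 * t)\<bar>"
        using N_mult_R_le[OF ij] s by (intro mult_mono) (auto simp del: of_nat_mult)
      finally have y: "real (N i) * \<bar>x\<bar> / 2 \<le> real (R i) * \<bar>sin (2 * t)\<bar>" .
      \<comment> \<open>With \<open>N i \<ge> 4\<close> the bound \<open>y\<close> exceeds
        \<open>2 * \<bar>x\<bar>\<close>, as the decay estimate requires.\<close>
      have "4 * \<bar>x\<bar> \<le> real (N i) * \<bar>x\<bar>" using N_ge_4[of i] by (intro mult_right_mono) auto
      then have "cmod (packet_wave (R i) (N i) t x) \<le> real (N i) * (8 / (real (R i) * sin (2 * t))\<^sup>2)"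
        using y s0 R_pos[of i] by (intro norm_packet_wave_decay) auto
      also have "\<dots> \<le> real (N i) * (8 / (real (N i) * \<bar>x\<bar> / 2)\<^sup>2)"
      proof -
        have "(real (N i) * \<bar>x\<bar> / 2)\<^sup>2 \<le> (real (R i) * \<bar>sin (2 * t)\<bar>)\<^sup>2"
          using y by (intro power_mono) auto
        then have "(real (N i) * \<bar>x\<bar> / 2)\<^sup>2 \<le> (real (R i) * sin (2 * t))\<^sup>2"
          by (simp add: power_mult_distrib)
        moreover have "0 < (real (N i) * \<bar>x\<bar> / 2)\<^sup>2" using x N_pos[of i] by simp
        ultimately show ?thesis
          by (intro mult_left_mono divide_left_mono mult_pos_pos) (use R_pos[of i] s0 in \<open>auto intro: less_le_trans\<close>)
      qed
      finally have "cmod (?w i) \<le> 8 ^ i / real (N i) * (real (N i) * (8 / (real (N i) * \<bar>x\<bar> / 2)\<^sup>2))"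
        unfolding norm_w by (intro mult_left_mono) auto
      also have "\<dots> = 32 / x\<^sup>2 * (8 ^ i / (real (N i))\<^sup>2)"
        using N_pos[of i] by (simp add: power_mult_distrib power_divide mult.commute)
      also have "\<dots> \<le> 32 / x\<^sup>2 * (8 ^ i / 16 ^ i)"
      proof -
        \<comment> \<open>The growth of \<open>N i\<close> beats the amplitude \<open>8 ^ i\<close>:
          the quotient \<open>8 ^ i / (N i)^2\<close> becomes geometric.\<close>
        have "(4::real) ^ i \<le> 4 ^ Suc i" by simp
        also have "\<dots> \<le> real (N i)" using N_ge[of i] by (metis of_nat_le_iff of_nat_numeral of_nat_power)
        finally have "(4 ^ i)\<^sup>2 \<le> (real (N i))\<^sup>2" by (intro power_mono) auto
        then have "(16::real) ^ i \<le> (real (N i))\<^sup>2"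
          by (simp add: power2_eq_square flip: power_mult_distrib)
        then show ?thesis using N_pos[of i] by (intro mult_left_mono divide_left_mono) auto
      qed
      also have "\<dots> = 32 / x\<^sup>2 * (1/2) ^ i" by (simp flip: power_divide)
      finally show "cmod (?w i) \<le> 32 / x\<^sup>2 * (1/2) ^ i" .
    qed
    also have "\<dots> = 32 / x\<^sup>2 * (\<Sum>i\<in>{j<..<J}. (1/2) ^ i)" by (simp add: sum_distrib_left)
    also have "\<dots> \<le> 32 / x\<^sup>2 * (\<Sum>i. (1/2) ^ i)"
      by (intro mult_left_mono sum_le_suminf) (auto simp: summable_geometric)
    also have "(\<Sum>i. (1/2) ^ i) = (2::real)" by (simp add: suminf_geometric)
    finally show ?thesis by simp
  qed
  ultimately have "8 ^ j / 2 - 8 ^ j / 7 - 64 / x\<^sup>2 \<le> cmod (packet_sum J t x)" by linarith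
  moreover have "(8::real) ^ j / 4 \<le> 8 ^ j / 2 - 8 ^ j / 7" by simp
  ultimately show ?thesis by linarith
qed

text \<open>The exact focusing times \<open>\<tau> j\<close> tend to 0. There the required
  inequalities hold strictly, and they are open conditions in \<open>t\<close>, so a nearby rational
  time satisfies them too.\<close>

lemma focus_time:
  assumes x: "x \<noteq> 0" and \<delta>: "0 < \<delta>"
  shows "\<forall>\<^sub>F j in sequentially. \<exists>t\<in>\<rat>. t \<noteq> 0 \<and> \<bar>t\<bar> < \<delta> \<and>
    1/2 * real (N j) \<le> cmod (packet_wave (R j) (N j) t x) \<and> \<bar>x\<bar> / (2 * real (R j)) \<le> \<bar>sin (2 * t)\<bar>"
proof -
  define \<tau> where "\<tau> j = arcsin (x / real (R j)) / 2" for j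
  have ratio: "\<bar>x / real (R j)\<bar> \<le> \<bar>x\<bar> / real (Suc j)" for j
  proof -
    have "Suc j * 1 \<le> R j" unfolding R_def using N_pos[of j] by (intro mult_left_mono) auto
    then have "real (Suc j) \<le> real (R j)" by simp
    then show ?thesis by (simp add: abs_divide frac_le del: of_nat_Suc)
  qed
  have "(\<lambda>j. x / real (R j)) \<longlonglongrightarrow> 0"
  proof (rule Lim_null_comparison)
    show "(\<lambda>j. \<bar>x\<bar> / real (Suc j)) \<longlonglongrightarrow> 0"
      using tendsto_mult[OF tendsto_const[of "\<bar>x\<bar>"] LIMSEQ_inverse_real_of_nat] by (simp add: divide_inverse)
    show "\<forall>\<^sub>F j in sequentially. norm (x / real (R j)) \<le> \<bar>x\<bar> / real (Suc j)"
      using ratio by (intro always_eventually) simp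
  qed
  then have "\<tau> \<longlonglongrightarrow> arcsin 0 / 2"
    unfolding \<tau>_def[abs_def] by (intro tendsto_intros isCont_tendsto_compose[OF isCont_arcsin]) auto
  then have "\<forall>\<^sub>F j in sequentially. dist (\<tau> j) 0 < \<delta>" using \<delta> by (auto dest: tendstoD)
  moreover have "\<forall>\<^sub>F j in sequentially. 2 * \<bar>x\<bar> \<le> real j"
    using filterlim_real_sequentially by (simp add: filterlim_at_top)
  ultimately show ?thesis
  proof eventually_elim
    case (elim j)
    have N: "0 < real (N j)" "0 < real (R j)" using N_pos R_pos by auto
    \<comment> \<open>Only for arguments in \<open>[-1, 1]\<close> does \<open>arcsin\<close> invert
      the sine.\<close>
    have "\<bar>x / real (R j)\<bar> \<le> 1"
      using ratio[of j] elim(2) by (smt (verit) abs_ge_zero divide_le_eq_1 of_nat_Suc of_nat_0_le_iff)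
    then have "- 1 \<le> x / real (R j)" "x / real (R j) \<le> 1" by linarith+
    then have sin: "sin (2 * \<tau> j) = x / real (R j)" by (simp add: \<tau>_def sin_arcsin)
    have "2 * \<bar>x\<bar> * (real (N j))\<^sup>2 \<le> real (Suc j) * (real (N j))\<^sup>2"
      using elim(2) by (intro mult_right_mono) auto
    then have "3/4 * real (N j) \<le> cmod (packet_wave (R j) (N j) (\<tau> j) x)"
      using N_pos[of j] R_pos[of j] by (intro norm_packet_wave_focus[OF sin]) (auto simp: R_def distrib_right)
    then have 1: "1/2 * real (N j) < cmod (packet_wave (R j) (N j) (\<tau> j) x)" using N by linarith
    have 2: "\<bar>x\<bar> / (2 * real (R j)) < \<bar>sin (2 * \<tau> j)\<bar>"
      unfolding sin using x N by (simp add: field_simps)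
    have cont: "isCont (\<lambda>t. packet_wave (R j) (N j) t x) (\<tau> j)"
      using continuous_on_packet_wave[of UNIV] by (simp add: continuous_on_eq_continuous_at)
    have "\<forall>\<^sub>F t in nhds (\<tau> j). \<bar>t\<bar> < \<delta> \<and> 1/2 * real (N j) < cmod (packet_wave (R j) (N j) t x) \<and>
        \<bar>x\<bar> / (2 * real (R j)) < \<bar>sin (2 * t)\<bar>"
    proof (intro eventually_conj)
      have "((\<lambda>t. \<bar>t\<bar>) \<longlongrightarrow> \<bar>\<tau> j\<bar>) (nhds (\<tau> j))" by (intro tendsto_intros filterlim_ident)
      then show "\<forall>\<^sub>F t in nhds (\<tau> j). \<bar>t\<bar> < \<delta>" using elim(1) by (auto dest: order_tendstoD)
      have "((\<lambda>t. cmod (packet_wave (R j) (N j) t x)) \<longlongrightarrow> cmod (packet_wave (R j) (N j) (\<tau> j) x)) (nhds (\<tau> j))"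
        using cont tendsto_at_iff_tendsto_nhds[of "\<lambda>t. packet_wave (R j) (N j) t x"]
        by (intro tendsto_norm) (simp add: isCont_def)
      then show "\<forall>\<^sub>F t in nhds (\<tau> j). 1/2 * real (N j) < cmod (packet_wave (R j) (N j) t x)"
        using 1 by (rule order_tendstoD)
      have "((\<lambda>t. \<bar>sin (2 * t)\<bar>) \<longlongrightarrow> \<bar>sin (2 * \<tau> j)\<bar>) (nhds (\<tau> j))"
        by (intro tendsto_intros filterlim_ident)
      then show "\<forall>\<^sub>F t in nhds (\<tau> j). \<bar>x\<bar> / (2 * real (R j)) < \<bar>sin (2 * t)\<bar>"
        using 2 by (rule order_tendstoD)
    qed
    then obtain d where d: "0 < d" "\<And>t. dist t (\<tau> j) < d \<Longrightarrow> \<bar>t\<bar> < \<delta> \<and>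
        1/2 * real (N j) < cmod (packet_wave (R j) (N j) t x) \<and> \<bar>x\<bar> / (2 * real (R j)) < \<bar>sin (2 * t)\<bar>"
      unfolding eventually_nhds_metric by auto
    obtain t where t: "t \<in> \<rat>" "\<tau> j < t" "t < \<tau> j + d"
      using Rats_dense_in_real[of "\<tau> j" "\<tau> j + d"] d(1) by auto
    then have *: "\<bar>t\<bar> < \<delta>" "1/2 * real (N j) < cmod (packet_wave (R j) (N j) t x)"
      "\<bar>x\<bar> / (2 * real (R j)) < \<bar>sin (2 * t)\<bar>"
      using d(2)[of t] by (auto simp: dist_real_def)
    \<comment> \<open>At \<open>t = 0\<close> the sine vanishes, against its strict lower
      bound.\<close>
    then have "t \<noteq> 0" using N by (auto simp: divide_less_0_iff)
    with * t show ?case by (intro bexI[of _ t]) auto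
  qed
qed

text \<open>A finite upper limit would bound \<open>h\<close> on a punctured neighbourhood of 0,
  which contains rational focusing times with arbitrarily large
  \<open>8 ^ j / 4 - 64 / x^2\<close>.\<close>

lemma Limsup_packet_limit:
  assumes x: "x \<noteq> 0" and h: "\<And>t. t \<in> \<rat> \<Longrightarrow> (\<lambda>J. packet_sum J t x) \<longlonglongrightarrow> h t"
  shows "Limsup (at 0) (\<lambda>t. ereal (cmod (h t))) = \<infinity>"
proof (rule ccontr)
  assume "Limsup (at 0) (\<lambda>t. ereal (cmod (h t))) \<noteq> \<infinity>"
  then have "Limsup (at 0) (\<lambda>t. ereal (cmod (h t))) < \<infinity>" by simp
  then obtain M where "Limsup (at 0) (\<lambda>t. ereal (cmod (h t))) < ereal M"
    using ereal_dense2[of "Limsup (at 0) (\<lambda>t. ereal (cmod (h t)))" \<infinity>] by auto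
  then have "\<forall>\<^sub>F t in at 0. ereal (cmod (h t)) < ereal M" by (rule Limsup_lessD)
  then obtain \<delta> where \<delta>: "0 < \<delta>" "\<And>t. t \<noteq> 0 \<Longrightarrow> dist t 0 < \<delta> \<Longrightarrow> cmod (h t) < M"
    unfolding eventually_at by auto
  have "filterlim (\<lambda>j. (8::real) ^ j) at_top sequentially"
    by (rule filterlim_at_infinity_imp_filterlim_at_top[OF filterlim_realpow_sequentially_gt1]) auto
  then have "\<forall>\<^sub>F j in sequentially. 4 * (M + 64 / x\<^sup>2) \<le> (8::real) ^ j" by (simp add: filterlim_at_top)
  from eventually_conj[OF this focus_time[OF x \<delta>(1)]]
  obtain j t where j: "4 * (M + 64 / x\<^sup>2) \<le> (8::real) ^ j" and t: "t \<in> \<rat>" "t \<noteq> 0" "\<bar>t\<bar> < \<delta>"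
      "1/2 * real (N j) \<le> cmod (packet_wave (R j) (N j) t x)" "\<bar>x\<bar> / (2 * real (R j)) \<le> \<bar>sin (2 * t)\<bar>"
    by (auto dest!: eventually_happens simp: trivial_limit_sequentially)
  have "8 ^ j / 4 - 64 / x\<^sup>2 \<le> cmod (h t)"
  proof (rule tendsto_lowerbound[OF tendsto_norm[OF h[OF t(1)]]])
    show "\<forall>\<^sub>F J in sequentially. 8 ^ j / 4 - 64 / x\<^sup>2 \<le> cmod (packet_sum J t x)"
      using eventually_gt_at_top[of j] by eventually_elim (rule norm_packet_sum_ge[OF t(4,5) x])
  qed simp
  moreover have "cmod (h t) < M" using t by (intro \<delta>(2)) auto
  moreover have "M \<le> 8 ^ j / 4 - 64 / x\<^sup>2" using j by (simp add: field_simps)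
  ultimately show False by linarith
qed

end

text \<open>\<open>u\<close> is an arbitrary choice of representatives, one for each time, so no
  regularity in \<open>t\<close> is at hand. Divergence is read off along rational times, and the
  upper limit expresses it.\<close>

theorem theorem11:
  fixes a :: real
  assumes "0 < a" and "a < 1 / 4"
  shows "\<exists>f \<in> hermite_sobolev a.
    \<forall>u :: real \<Rightarrow> real \<Rightarrow> complex. (\<forall>t. hermite_schroedinger t f (u t)) \<longrightarrow>
      (AE x in lborel. Limsup (at 0) (\<lambda>t. ereal (cmod (u t x))) = \<infinity>)"
proof -
  obtain N :: "nat \<Rightarrow> nat" where N: "\<And>j. 4 ^ Suc j \<le> N j" "\<And>j. Suc j * (N j)\<^sup>2 \<le> N (Suc j)"
    "\<And>j. (8 ^ j / real (N j))\<^sup>2 * (108 * real (N j) * real (Suc j * (N j)\<^sup>2) powr (2 * a)) \<le> (1/16) ^ j"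
    using packet_sizes_exist[OF assms] by blast
  interpret packet_sequence N by unfold_locales (rule N)+
  \<comment> \<open>\<open>A j\<close> holds the coefficients of the scaled comb, and
    \<open>v j\<close> those of its image under the power \<open>a / 2\<close> of \<open>H\<close>.
    The sum \<open>b\<close> of the \<open>v j\<close> yields the preimage \<open>g\<close>, and
    \<open>c\<close>, which is \<open>b\<close> divided by \<open>W\<close>, yields
    \<open>f\<close>.\<close>
  define W where "W k = (2 * real k + 1) powr (a / 2)" for k
  define A where "A j k = of_real (8 ^ j / real (N j)) * packet_coeff (R j) (N j) k" for j k
  define v where "v j k = of_real (W k) * A j k" for j k
  have W: "1 \<le> W k" for k using assms by (simp add: W_def ge_one_powr_ge_zero)
  have v: "(\<Sum>k<n. (cmod (v j k))\<^sup>2) \<le> (1/16) ^ j" for j n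
  proof -
    have "(\<Sum>k<n. (cmod (v j k))\<^sup>2) = (8 ^ j / real (N j))\<^sup>2 * (\<Sum>k<n. (W k * cmod (packet_coeff (R j) (N j) k))\<^sup>2)"
      using W by (simp add: v_def A_def norm_mult norm_divide norm_power power_mult_distrib sum_distrib_left
          power_divide mult_ac)
    also have "\<dots> \<le> (8 ^ j / real (N j))\<^sup>2 * (108 * real (N j) * real (R j) powr (2 * a))"
      unfolding W_def using assms N_pos[of j]
      by (intro mult_left_mono packet_coeff_weighted_le N_le_R) auto
    also have "\<dots> \<le> (1/16) ^ j" using N(3)[of j] by (simp add: R_def)
    finally show ?thesis .
  qed
  note tail = l2_geometric_series(2)[of v, OF v]
  define b where "b k = (\<Sum>j. v j k)" for k
  define c where "c k = of_real ((2 * real k + 1) powr (- a / 2)) * b k" for k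
  define C where "C J k = (\<Sum>j<J. A j k)" for J k
  \<comment> \<open>Since \<open>W k \<ge> 1\<close>, the tail bounds for the weighted coefficients
    carry over to the unweighted ones.\<close>
  have cC: "cmod (c k - C J k) \<le> cmod (b k - (\<Sum>j<J. v j k))" for J k
  proof -
    have inv: "(2 * real k + 1) powr (- a / 2) = 1 / W k"
      by (simp add: W_def powr_minus_divide)
    have "b k - (\<Sum>j<J. v j k) = of_real (W k) * (c k - C J k)"
      unfolding c_def C_def v_def inv using W[of k] by (simp add: right_diff_distrib sum_distrib_left)
    then have "cmod (b k - (\<Sum>j<J. v j k)) = W k * cmod (c k - C J k)"
      using W[of k] by (simp add: norm_mult)
    then show ?thesis using mult_right_mono[OF W[of k], of "cmod (c k - C J k)"] by simp
  qed
  have c_tail: "(\<Sum>k<n. (cmod (c k - C J k))\<^sup>2) \<le> 16/9 * (1/16) ^ J" for n J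
    by (rule order_trans[OF _ tail[where n = n and J = J]]) (auto intro!: sum_mono power_mono simp: cC simp flip: b_def)
  have b_l2: "summable (\<lambda>k. (cmod (b k))\<^sup>2)"
    using tail[where J = 0] by (intro summableI_nonneg_bounded[of _ "16/9"]) (auto simp: b_def)
  have c_bound: "(\<Sum>k<n. (cmod (c k))\<^sup>2) \<le> 16/9" for n
    using c_tail[where J = 0] by (simp add: C_def)
  have c_l2: "summable (\<lambda>k. (cmod (c k))\<^sup>2)"
    using c_bound by (intro summableI_nonneg_bounded[of _ "16/9"]) auto
  have C_l2: "summable (\<lambda>k. (cmod (C J k))\<^sup>2)" for J
  proof (rule summableI_nonneg_bounded)
    fix n
    have "(\<Sum>k<n. (cmod (C J k))\<^sup>2) \<le> (\<Sum>k<n. 2 * (cmod (c k))\<^sup>2 + 2 * (cmod (C J k - c k))\<^sup>2)"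
    proof (intro sum_mono)
      show "(cmod (C J k))\<^sup>2 \<le> 2 * (cmod (c k))\<^sup>2 + 2 * (cmod (C J k - c k))\<^sup>2" for k
        using cmod_add_square_le[of "c k" "C J k - c k"] by simp
    qed
    also have "\<dots> = 2 * (\<Sum>k<n. (cmod (c k))\<^sup>2) + 2 * (\<Sum>k<n. (cmod (c k - C J k))\<^sup>2)"
      by (simp add: sum.distrib sum_distrib_left norm_minus_commute)
    also have "\<dots> \<le> 2 * (16/9) + 2 * (16/9 * (1/16) ^ J)"
      by (intro add_mono mult_left_mono c_bound c_tail) auto
    finally show "(\<Sum>k<n. (cmod (C J k))\<^sup>2) \<le> 2 * (16/9) + 2 * (16/9 * (1/16) ^ J)" .
  qed simp
  obtain g where g: "hermite_expansion b g" using hermite_expansion_exists[OF b_l2] by blast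
  obtain f where f: "hermite_expansion c f" using hermite_expansion_exists[OF c_l2] by blast
  have "f \<in> hermite_sobolev a"
    unfolding hermite_sobolev_def hermite_calculus_def
    using g f hermite_expansion_L2[OF g] by (auto simp: c_def[abs_def])
  moreover have "AE x in lborel. Limsup (at 0) (\<lambda>t. ereal (cmod (u t x))) = \<infinity>"
    if u: "\<forall>t. hermite_schroedinger t f (u t)" for u
  proof -
    have phase: "cmod (hermite_phase t k) = 1" for t k
      by (simp add: hermite_phase_def norm_exp_eq_Re)
    \<comment> \<open>Uniqueness identifies the coefficients hidden in the definition of the
      evolution with \<open>c\<close>.\<close>
    have u_exp: "hermite_expansion (\<lambda>k. hermite_phase t k * c k) (u t)" for t
    proof -
      obtain c' where c': "hermite_expansion c' f" "hermite_expansion (\<lambda>k. hermite_phase t k * c' k) (u t)"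
        using u unfolding hermite_schroedinger_def hermite_calculus_def hermite_phase_def by blast
      then show ?thesis using hermite_expansion_unique[OF f c'(1)] by simp
    qed
    \<comment> \<open>The evolved Hermite series of finitely many combs converges at every point, so
      the closed form \<open>packet_sum\<close> is a representative of its sum.\<close>
    have p_exp: "hermite_expansion (\<lambda>k. hermite_phase t k * C J k) (packet_sum J t)" for t J
    proof (rule hermite_expansion_pointwise[where r = id])
      show "summable (\<lambda>k. (cmod (hermite_phase t k * C J k))\<^sup>2)"
        using C_l2 by (simp add: norm_mult phase)
      show "packet_sum J t \<in> borel_measurable borel" unfolding packet_sum_def[abs_def] by measurable
      have "(\<lambda>k. hermite_phase t k * C J k * of_real (hermite_fun k x)) sums packet_sum J t x" for x
      proof -
        have "(\<lambda>k. \<Sum>j<J. of_real (8 ^ j / real (N j)) *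
            (hermite_phase t k * packet_coeff (R j) (N j) k * of_real (hermite_fun k x))) sums packet_sum J t x"
          unfolding packet_sum_def by (intro sums_sum sums_mult packet_wave_sums)
        moreover have "(\<Sum>j<J. of_real (8 ^ j / real (N j)) *
            (hermite_phase t k * packet_coeff (R j) (N j) k * of_real (hermite_fun k x))) =
            hermite_phase t k * C J k * of_real (hermite_fun k x)" for k
          unfolding C_def A_def sum_distrib_left sum_distrib_right by (simp only: mult_ac)
        ultimately show ?thesis by simp
      qed
      then show "AE x in lborel. (\<lambda>i. hermite_partial (\<lambda>k. hermite_phase t k * C J k) (id i) x) \<longlonglongrightarrow> packet_sum J t x"
        by (simp add: sums_def hermite_partial_def)
    qed (simp add: strict_mono_def)
    have conv: "AE x in lborel. (\<lambda>J. packet_sum J t x) \<longlonglongrightarrow> u t x" for t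
    proof -
      have L2: "u t \<in> L2" "packet_sum J t \<in> L2" for J
        using u_exp p_exp by (auto intro: hermite_expansion_L2)
      have energy: "L2_energy (\<lambda>x. u t x - packet_sum J t x) \<le> 32/9 * (1/16) ^ J" for J
      proof -
        have "(\<Sum>k<n. (cmod (hermite_phase t k * c k - hermite_phase t k * C J k))\<^sup>2) \<le> 16/9 * (1/16) ^ J" for n
          using c_tail[of J n] by (simp add: norm_mult phase flip: right_diff_distrib)
        from hermite_expansion_energy_diff_le[OF u_exp p_exp this] show ?thesis by simp
      qed
      \<comment> \<open>The energies decay geometrically in \<open>J\<close>, so the whole sequence,
        not just a subsequence, converges almost everywhere.\<close>
      have "AE x in lborel. summable (\<lambda>J. (cmod (u t x - packet_sum J t x))\<^sup>2)"
      proof (rule AE_summable_L2)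
        show "summable (\<lambda>J. L2_energy (\<lambda>x. u t x - packet_sum J t x))"
        proof (rule summable_comparison_test)
          show "summable (\<lambda>J. 32/9 * (1/16::real) ^ J)" by (intro summable_mult summable_geometric) simp
        qed (use energy in \<open>auto simp: L2_energy_nonneg\<close>)
      qed (intro L2_diff L2)
      then show ?thesis
      proof eventually_elim
        case (elim x)
        then have "(\<lambda>J. (cmod (u t x - packet_sum J t x))\<^sup>2) \<longlonglongrightarrow> 0" by (rule summable_LIMSEQ_zero)
        from tendsto_real_sqrt[OF this] have "(\<lambda>J. cmod (u t x - packet_sum J t x)) \<longlonglongrightarrow> 0" by simp
        then have "(\<lambda>J. u t x - packet_sum J t x) \<longlonglongrightarrow> 0" by (rule tendsto_norm_zero_cancel)
        from tendsto_diff[OF tendsto_const[of "u t x"] this] show ?case by simp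
      qed
    qed
    \<comment> \<open>Countably many null sets, one for each rational time, have a null
      union.\<close>
    then have "AE x in lborel. \<forall>t\<in>\<rat>. (\<lambda>J. packet_sum J t x) \<longlonglongrightarrow> u t x"
      by (subst AE_ball_countable) (auto simp: countable_rat)
    moreover have "AE x in lborel. x \<noteq> (0::real)" by (rule AE_lborel_singleton)
    ultimately show ?thesis
      by eventually_elim (auto intro!: Limsup_packet_limit)
  qed
  ultimately show ?thesis by blast
qed

end
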